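(* Let $p=\frac{r}{s}\in\mathbb{Q}$ with $r>s$ positive integers and $\gcd(r,s)=1$, and suppose that the $p$-order feasibility problem $(\mathbf{F}_p)$ with data $F\in\mathbb{Z}^{m\times n}$, $G,H\in\mathbb{Z}^m$ of bit size at most $\tau$ is feasible. Then: (1) There exists a feasible solution $(x,z)$ of $(\mathbf{F}_p)$ such that $\|(x,z)\|_2\le R$, where $\log R=\tau(nr)^{O(n\min\{m,n\})}$. (2) Moreover, if the feasible set of $(\mathbf{F}_p)$ is bounded, then the bound in (1) holds for any feasible solution of $(\mathbf{F}_p)$.
   Context: For rational $p>1$, the $p$-order cone is $\mathcal{K}_p^n:=\{(x,z)\in\mathbb{R}^{n}\times\mathbb{R}: \|x\|_p\le z\}$, where $\|x\|_p=(\sum_{i=1}^n|x_i|^p)^{1/p}$. Given $F\in\mathbb{Z}^{m\times n}$, $G,H\in\mathbb{Z}^m$ ($m\ge 1$), a feasible solution of the $p$-order feasibility problem $(\mathbf{F}_p)$ is a vector $(x,z)\in\mathbb{R}^{n+1}$ with $Fx+Gz\le H$ (componentwise) and $(x,z)\in\mathcal{K}_p^n$; the problem is feasible if such a vector exists. Standing assumption: $n\ge2$. $\tau$ denotes the maximum bit size of the entries of $F,G,H$; the bit size of an integer $b\neq0$ is $\lfloor\log_2|b|\rfloor+1$, and that of $0$ is $1$. $R$ depends only on $p,n,m,\tau$. For $g,h:\mathbb{N}^l\to\mathbb{R}_{>0}$, $g(v)=O(h(v))$ means that there are $b,N\in\mathbb{N}$ with $g(v)\le b\,h(v)$ whenever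 all coordinates of $v$ are at least $N$; an $O(\cdot)$ inside an exponent stands for some function of that class. *)

theory Defs
  imports
    Complex_Main
    "HOL-Library.Landau_Symbols"
    "Jordan_Normal_Form.Matrix"
begin

definition bit_size :: "int \<Rightarrow> nat" where
  "bit_size b = (if b = 0 then 1 else nat \<lfloor>log 2 \<bar>real_of_int b\<bar>\<rfloor> + 1)"

(* 0 powr a = 0, so zero entries (and the zero vector) get the intended value for p > 0. *)
definition p_norm :: "real \<Rightarrow> real vec \<Rightarrow> real" where
  "p_norm p x = (\<Sum>i<dim_vec x. \<bar>x $ i\<bar> powr p) powr (1 / p)"

definition p_order_cone :: "real \<Rightarrow> nat \<Rightarrow> (real vec \<times> real) set" where
  "p_order_cone p n = {(x, z). x \<in> carrier_vec n \<and> p_norm p x \<le> z}"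

(* The order on vectors is componentwise, and includes equality of the dimensions. *)
definition feasible_set ::
    "real \<Rightarrow> int mat \<Rightarrow> int vec \<Rightarrow> int vec \<Rightarrow> (real vec \<times> real) set" where
  "feasible_set p F G H =
     {(x, z). map_mat real_of_int F *\<^sub>v x + z \<cdot>\<^sub>v map_vec real_of_int G
                \<le> map_vec real_of_int H \<and>
              (x, z) \<in> p_order_cone p (dim_col F)}"

definition norm2 :: "real vec \<times> real \<Rightarrow> real" where
  "norm2 = (\<lambda>(x, z). sqrt ((\<Sum>i<dim_vec x. (x $ i)\<^sup>2) + z\<^sup>2))"

(* real vec carries no metric, so boundedness is spelled out as in bounded_iff. *)
definition norm2_bounded :: "(real vec \<times> real) set \<Rightarrow> bool" where
  "norm2_bounded S \<longleftrightarrow> (\<exists>B. \<forall>w\<in>S. norm2 w \<le> B)"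

definition entries_bit_size_le :: "int mat \<Rightarrow> int vec \<Rightarrow> int vec \<Rightarrow> nat \<Rightarrow> bool" where
  "entries_bit_size_le F G H \<tau> \<longleftrightarrow>
     (\<forall>i<dim_row F. \<forall>j<dim_col F. bit_size (F $$ (i, j)) \<le> \<tau>) \<and>
     (\<forall>i<dim_vec G. bit_size (G $ i) \<le> \<tau>) \<and>
     (\<forall>i<dim_vec H. bit_size (H $ i) \<le> \<tau>)"

(* O(.) for positive functions of two natural numbers: the bound is required once both
   coordinates are at least N.  The lemma below identifies it with the library's notion. *)
definition bigO2 :: "(nat \<Rightarrow> nat \<Rightarrow> real) \<Rightarrow> (nat \<Rightarrow> nat \<Rightarrow> real) \<Rightarrow> bool" where
  "bigO2 g h \<longleftrightarrow> (\<exists>b N :: nat. \<forall>m n. m \<ge> N \<longrightarrow> n \<ge> N \<longrightarrow> g m n \<le> real b * h m n)"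

lemma bigO2_iff_landau:
  assumes "\<And>m n. m \<ge> 1 \<Longrightarrow> n \<ge> 1 \<Longrightarrow> g m n > 0" "\<And>m n. m \<ge> 1 \<Longrightarrow> n \<ge> 1 \<Longrightarrow> h m n > 0"
  shows "bigO2 g h \<longleftrightarrow>
    (\<lambda>(m, n). g m n) \<in> O[sequentially \<times>\<^sub>F sequentially](\<lambda>(m, n). h m n)"
proof
  assume "bigO2 g h"
  then obtain b N :: nat where
    N: "\<And>m n. m \<ge> N \<Longrightarrow> n \<ge> N \<Longrightarrow> g m n \<le> real b * h m n"
    unfolding bigO2_def by blast
  have "\<bar>g m n\<bar> \<le> real b * \<bar>h m n\<bar>" if "m \<ge> max N 1" "n \<ge> max N 1" for m n
    using N[of m n] assms(1)[of m n] assms(2)[of m n] that by simp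
  then have "\<forall>\<^sub>F (m, n) in sequentially \<times>\<^sub>F sequentially. \<bar>g m n\<bar> \<le> real b * \<bar>h m n\<bar>"
    unfolding eventually_prod_sequentially by blast
  then show "(\<lambda>(m, n). g m n) \<in> O[sequentially \<times>\<^sub>F sequentially](\<lambda>(m, n). h m n)"
    by (intro bigoI[where c = "real b"]) (simp add: case_prod_unfold)
next
  assume "(\<lambda>(m, n). g m n) \<in> O[sequentially \<times>\<^sub>F sequentially](\<lambda>(m, n). h m n)"
  then obtain c where
    "\<forall>\<^sub>F (m, n) in sequentially \<times>\<^sub>F sequentially. \<bar>g m n\<bar> \<le> c * \<bar>h m n\<bar>"
    by (elim landau_o.bigE) (simp add: case_prod_unfold)
  then obtain N where N: "\<And>m n. m \<ge> N \<Longrightarrow> n \<ge> N \<Longrightarrow> \<bar>g m n\<bar> \<le> c * \<bar>h m n\<bar>"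
    unfolding eventually_prod_sequentially by auto
  obtain b :: nat where b: "c \<le> real b"
    using real_arch_simple by blast
  have "g m n \<le> real b * h m n" if "m \<ge> max N 1" "n \<ge> max N 1" for m n
  proof -
    have h: "h m n > 0" using assms(2)[of m n] that by simp
    have "g m n \<le> c * h m n" using N[of m n] h that by simp
    also have "\<dots> \<le> real b * h m n" using b h by (intro mult_right_mono) auto
    finally show ?thesis .
  qed
  then show "bigO2 g h" unfolding bigO2_def by blast
qed

end

(*
  Write p = r/s.  On each orthant, the substitution x_i = +-u_i^s, z = u_n^s turns the problem into a
  system of polynomial inequalities g_j(u) >= 0, and bounding z over the cone bounds the whole vector.
  An extremal value of z is the limit, as eps -> 0, of critical points of the perturbed barrier function
  +-u_n + sum_i a_i u_i - sum_j tau_j ln (g_j(u) + delta), whose parameters a_i, tau_j, delta are the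
  powers eps^(L^i).  With lambda_j = tau_j / (g_j + delta), the critical equations say that M integer
  polynomials f_i in the M unknowns (u, lambda, delta) take the values eps^(L^i).  By counting dimensions
  (pigeonhole), f_0, ..., f_(M-1) and u_n satisfy an algebraic relation with small integer coefficients; its
  monomials in the f_i take the values eps^c for distinct c, so the lowest power of eps yields a nonzero
  integer polynomial that vanishes at the limit of u_n, and Cauchy's root bound applies.
  Finally M has to be independent of the number of inequalities: by Helly's theorem at most
  n + 2 halfspaces have to be considered at a time, so that M <= 3 n + 6.
*)
theory Submission
  imports Defs "HOL-Analysis.Function_Metric" "HOL-Analysis.Convex"
begin

section \<open>Integer polynomials and elimination\<close>

text \<open>The relation found by counting is an identity in all unknowns. Hence nothing has to be
  known about the critical points: they need not be isolated or unique, and the multipliers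
  \<lambda> may diverge as \<epsilon> tends to 0; only \<open>u_n\<close> has to converge. Nor does
  a resultant have to be shown nonzero. The perturbation is forced. The feasible set may have empty
  interior, and powers of \<open>u_i\<close> with exponent above 1 have vanishing gradient at
  \<open>u_i = 0\<close>, so an optimum itself need not obey any multiplier rule. The shift \<delta>
  creates interior points. The price is one unknown per constraint. Since \<open>M\<close> occurs in
  the exponent of \<open>L = 2 * (2 * M * d) ^ M\<close>, keeping all multipliers would make the
  final exponent grow with the number of inequalities, even for fixed dimension. After Helly's
  theorem the exponent of \<open>n * r\<close> is \<open>33 * n\<close>.\<close>

definition monom_fun :: "nat \<Rightarrow> (nat \<Rightarrow> nat) \<Rightarrow> (nat \<Rightarrow> real) \<Rightarrow> real" where
  "monom_fun M \<alpha> v = (\<Prod>i<M. v i ^ \<alpha> i)"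

definition exps :: "nat \<Rightarrow> nat \<Rightarrow> (nat \<Rightarrow> nat) set" where
  "exps M D = PiE {..<M} (\<lambda>_. {..D})"

text \<open>Polynomials enter only as functions with a witnessing coefficient family. The degree is
  bounded in each variable separately, which makes \<open>exps\<close> a box that is easy to count;
  the size is the sum of the absolute coefficients because that is submultiplicative.\<close>

definition int_poly_fun :: "nat \<Rightarrow> nat \<Rightarrow> nat \<Rightarrow> ((nat \<Rightarrow> real) \<Rightarrow> real) \<Rightarrow> bool" where
  "int_poly_fun M D C f \<longleftrightarrow>
     (\<exists>c :: (nat \<Rightarrow> nat) \<Rightarrow> int.
        (\<forall>v. f v = (\<Sum>\<alpha>\<in>exps M D. of_int (c \<alpha>) * monom_fun M \<alpha> v)) \<and>
        (\<Sum>\<alpha>\<in>exps M D. \<bar>c \<alpha>\<bar>) \<le> int C)"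

lemma finite_exps [simp]: "finite (exps M D)"
  by (simp add: exps_def finite_PiE)

lemma card_exps: "card (exps M D) = (D + 1) ^ M"
  by (simp add: exps_def card_PiE)

lemma exps_mono: "D \<le> D' \<Longrightarrow> exps M D \<subseteq> exps M D'"
  by (force simp: exps_def PiE_def Pi_def)

lemma int_poly_fun_mono:
  assumes "int_poly_fun M D C f" "D \<le> D'" "C \<le> C'"
  shows "int_poly_fun M D' C' f"
proof -
  obtain c where c: "\<And>v. f v = (\<Sum>\<alpha>\<in>exps M D. of_int (c \<alpha>) * monom_fun M \<alpha> v)"
    "(\<Sum>\<alpha>\<in>exps M D. \<bar>c \<alpha>\<bar>) \<le> int C"
    using assms(1) unfolding int_poly_fun_def by blast
  define c' where "c' \<alpha> = (if \<alpha> \<in> exps M D then c \<alpha> else 0)" for \<alpha>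
  have sub: "exps M D \<subseteq> exps M D'" using assms exps_mono by blast
  have "f v = (\<Sum>\<alpha>\<in>exps M D'. of_int (c' \<alpha>) * monom_fun M \<alpha> v)" for v
    unfolding c(1) using sub by (intro sum.mono_neutral_cong_left) (auto simp: c'_def)
  moreover have "(\<Sum>\<alpha>\<in>exps M D'. \<bar>c' \<alpha>\<bar>) = (\<Sum>\<alpha>\<in>exps M D. \<bar>c \<alpha>\<bar>)"
    using sub by (intro sum.mono_neutral_cong_right) (auto simp: c'_def)
  ultimately show ?thesis
    unfolding int_poly_fun_def using c(2) assms(3) by (intro exI[of _ c']) auto
qed

lemma int_poly_fun_monom:
  assumes "\<alpha> \<in> exps M D"
  shows "int_poly_fun M D (nat \<bar>a\<bar>) (\<lambda>v. of_int a * monom_fun M \<alpha> v)"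
proof -
  have "(\<Sum>\<beta>\<in>exps M D. real_of_int (if \<beta> = \<alpha> then a else 0) * monom_fun M \<beta> v)
      = (\<Sum>\<beta>\<in>exps M D. if \<beta> = \<alpha> then of_int a * monom_fun M \<beta> v else 0)" for v
    by (intro sum.cong) auto
  moreover have "(\<Sum>\<beta>\<in>exps M D. \<bar>if \<beta> = \<alpha> then a else 0\<bar>) = (\<Sum>\<beta>\<in>exps M D. if \<beta> = \<alpha> then \<bar>a\<bar> else 0)"
    by (intro sum.cong) auto
  ultimately show ?thesis
    unfolding int_poly_fun_def
    using assms by (intro exI[of _ "\<lambda>\<beta>. if \<beta> = \<alpha> then a else 0"]) simp
qed

lemma int_poly_fun_const: "int_poly_fun M D (nat \<bar>a\<bar>) (\<lambda>v. of_int a)"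
proof -
  have "restrict (\<lambda>_. 0) {..<M} \<in> exps M D" by (simp add: exps_def)
  from int_poly_fun_monom[OF this, of a] show ?thesis by (simp add: monom_fun_def)
qed

lemma int_poly_fun_coord:
  assumes "i < M"
  shows "int_poly_fun M 1 1 (\<lambda>v. v i)"
proof -
  let ?\<alpha> = "restrict (\<lambda>j. if j = i then 1 else 0 :: nat) {..<M}"
  have "monom_fun M ?\<alpha> v = (\<Prod>j<M. if j = i then v j else 1)" for v
    unfolding monom_fun_def by (intro prod.cong) auto
  then have "monom_fun M ?\<alpha> v = v i" for v
    using assms by simp
  moreover have "?\<alpha> \<in> exps M 1"
    by (auto simp: exps_def)
  ultimately show ?thesis
    using int_poly_fun_monom[of ?\<alpha> M 1 1] by simp
qed

lemma int_poly_fun_add: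
  assumes "int_poly_fun M D C f" "int_poly_fun M D C' g"
  shows "int_poly_fun M D (C + C') (\<lambda>v. f v + g v)"
proof -
  obtain c where c: "\<And>v. f v = (\<Sum>\<alpha>\<in>exps M D. of_int (c \<alpha>) * monom_fun M \<alpha> v)"
    "(\<Sum>\<alpha>\<in>exps M D. \<bar>c \<alpha>\<bar>) \<le> int C"
    using assms(1) unfolding int_poly_fun_def by blast
  obtain c' where c': "\<And>v. g v = (\<Sum>\<alpha>\<in>exps M D. of_int (c' \<alpha>) * monom_fun M \<alpha> v)"
    "(\<Sum>\<alpha>\<in>exps M D. \<bar>c' \<alpha>\<bar>) \<le> int C'"
    using assms(2) unfolding int_poly_fun_def by blast
  have "(\<Sum>\<alpha>\<in>exps M D. \<bar>c \<alpha> + c' \<alpha>\<bar>) \<le> (\<Sum>\<alpha>\<in>exps M D. \<bar>c \<alpha>\<bar> + \<bar>c' \<alpha>\<bar>)"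
    by (intro sum_mono) auto
  also have "\<dots> \<le> int (C + C')" using c(2) c'(2) by (simp add: sum.distrib)
  finally show ?thesis
    unfolding int_poly_fun_def
    by (intro exI[of _ "\<lambda>\<alpha>. c \<alpha> + c' \<alpha>"]) (simp add: c c' sum.distrib algebra_simps)
qed

lemma int_poly_fun_sum:
  assumes "finite S" "\<And>j. j \<in> S \<Longrightarrow> int_poly_fun M D (C j) (f j)"
  shows "int_poly_fun M D (\<Sum>j\<in>S. C j) (\<lambda>v. \<Sum>j\<in>S. f j v)"
  using assms
proof (induction S rule: finite_induct)
  case empty
  then show ?case using int_poly_fun_const[of M D 0] by simp
next
  case (insert x F)
  then show ?case by (simp add: int_poly_fun_add)
qed

lemma int_poly_fun_mult:
  assumes "int_poly_fun M D C f" "int_poly_fun M D' C' g"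
  shows "int_poly_fun M (D + D') (C * C') (\<lambda>v. f v * g v)"
proof -
  obtain c where c: "\<And>v. f v = (\<Sum>\<alpha>\<in>exps M D. of_int (c \<alpha>) * monom_fun M \<alpha> v)"
    "(\<Sum>\<alpha>\<in>exps M D. \<bar>c \<alpha>\<bar>) \<le> int C"
    using assms(1) unfolding int_poly_fun_def by blast
  obtain c' where c': "\<And>v. g v = (\<Sum>\<alpha>\<in>exps M D'. of_int (c' \<alpha>) * monom_fun M \<alpha> v)"
    "(\<Sum>\<alpha>\<in>exps M D'. \<bar>c' \<alpha>\<bar>) \<le> int C'"
    using assms(2) unfolding int_poly_fun_def by blast
  define P where "P = exps M D \<times> exps M D'"
  define add where "add = (\<lambda>(\<alpha>, \<beta>). restrict (\<lambda>i. \<alpha> i + \<beta> i) {..<M} :: nat \<Rightarrow> nat)"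
  define e where "e \<gamma> = (\<Sum>x | x \<in> P \<and> add x = \<gamma>. c (fst x) * c' (snd x))" for \<gamma>
  have fin: "finite P" by (simp add: P_def)
  have sub: "add ` P \<subseteq> exps M (D + D')"
    by (auto simp: P_def add_def exps_def PiE_def Pi_def add_mono)
  have mon: "monom_fun M (add x) v = monom_fun M (fst x) v * monom_fun M (snd x) v" for x v
    by (cases x) (simp add: monom_fun_def add_def power_add prod.distrib)
  have "f v * g v = (\<Sum>\<gamma>\<in>exps M (D + D'). of_int (e \<gamma>) * monom_fun M \<gamma> v)" for v
  proof -
    have "f v * g v = (\<Sum>x\<in>P. (of_int (c (fst x)) * monom_fun M (fst x) v)
        * (of_int (c' (snd x)) * monom_fun M (snd x) v))"
      by (simp add: c c' sum_product sum.cartesian_product P_def case_prod_unfold)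
    also have "\<dots> = (\<Sum>x\<in>P. of_int (c (fst x) * c' (snd x)) * monom_fun M (add x) v)"
      by (intro sum.cong refl) (simp add: mon)
    also have "\<dots> = (\<Sum>\<gamma>\<in>exps M (D + D'). \<Sum>x | x \<in> P \<and> add x = \<gamma>.
        of_int (c (fst x) * c' (snd x)) * monom_fun M (add x) v)"
      by (intro sum.group[symmetric] fin sub finite_exps)
    also have "\<dots> = (\<Sum>\<gamma>\<in>exps M (D + D'). of_int (e \<gamma>) * monom_fun M \<gamma> v)"
      unfolding e_def of_int_sum sum_distrib_right by (intro sum.cong refl) auto
    finally show ?thesis .
  qed
  moreover have "(\<Sum>\<gamma>\<in>exps M (D + D'). \<bar>e \<gamma>\<bar>) \<le> int (C * C')"
  proof -
    have "(\<Sum>\<gamma>\<in>exps M (D + D'). \<bar>e \<gamma>\<bar>)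
        \<le> (\<Sum>\<gamma>\<in>exps M (D + D'). \<Sum>x | x \<in> P \<and> add x = \<gamma>. \<bar>c (fst x)\<bar> * \<bar>c' (snd x)\<bar>)"
      unfolding e_def by (intro sum_mono order_trans[OF sum_abs]) (simp add: abs_mult)
    also have "\<dots> = (\<Sum>x\<in>P. \<bar>c (fst x)\<bar> * \<bar>c' (snd x)\<bar>)"
      by (intro sum.group fin sub finite_exps)
    also have "\<dots> = (\<Sum>\<alpha>\<in>exps M D. \<bar>c \<alpha>\<bar>) * (\<Sum>\<alpha>\<in>exps M D'. \<bar>c' \<alpha>\<bar>)"
      by (simp add: sum_product sum.cartesian_product P_def case_prod_unfold)
    also have "\<dots> \<le> int C * int C'" by (intro mult_mono c c') (auto intro: sum_nonneg)
    finally show ?thesis by simp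
  qed
  ultimately show ?thesis unfolding int_poly_fun_def by blast
qed

lemma int_poly_fun_power:
  assumes "int_poly_fun M D C f"
  shows "int_poly_fun M (k * D) (C ^ k) (\<lambda>v. f v ^ k)"
proof (induction k)
  case 0
  then show ?case using int_poly_fun_const[of M 0 1] by simp
next
  case (Suc k)
  then show ?case using int_poly_fun_mult[OF assms Suc] by simp
qed

lemma int_poly_fun_prod:
  assumes "finite S" "\<And>j. j \<in> S \<Longrightarrow> int_poly_fun M (D j) (C j) (f j)"
  shows "int_poly_fun M (\<Sum>j\<in>S. D j) (\<Prod>j\<in>S. C j) (\<lambda>v. \<Prod>j\<in>S. f j v)"
  using assms
proof (induction S rule: finite_induct)
  case empty
  then show ?case using int_poly_fun_const[of M 0 1] by simp
next
  case (insert x F)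
  then show ?case by (simp add: int_poly_fun_mult)
qed

text \<open>Siegel's lemma: two vectors with entries in \<open>{0..Q}\<close> have the same image
  under the linear system, and their difference is the required solution. With twice as many
  unknowns as equations the bound stays linear in the coefficient size.\<close>

lemma siegel_pigeonhole:
  fixes c :: "'e \<Rightarrow> 'i \<Rightarrow> int" and C :: nat
  assumes fin: "finite I" "finite E" and ne: "I \<noteq> {}" and C: "C \<ge> 1"
    and bound: "\<And>e i. e \<in> E \<Longrightarrow> i \<in> I \<Longrightarrow> \<bar>c e i\<bar> \<le> int C"
    and card: "2 * card E \<le> card I"
  obtains A :: "'i \<Rightarrow> int" where
    "\<exists>i\<in>I. A i \<noteq> 0" "\<And>i. i \<in> I \<Longrightarrow> \<bar>A i\<bar> \<le> int (2 * card I * C)"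
    "\<And>e. e \<in> E \<Longrightarrow> (\<Sum>i\<in>I. A i * c e i) = 0"
proof -
  define h where "h = card I * C"
  have h1: "h \<ge> 1" using ne fin C by (simp add: h_def Suc_le_eq card_gt_0_iff)
  \<comment> \<open>With this \<open>Q\<close> an image coordinate takes at most
    \<open>2 * h * Q + 1 = Q^2 + 1\<close> values, fewer than \<open>(Q + 1)^2\<close>; so two
    unknowns per equation suffice.\<close>
  define Q where "Q = 2 * h"
  define X where "X = PiE I (\<lambda>_. {0..int Q})"
  define Y where "Y = PiE E (\<lambda>_. {- int (h * Q)..int (h * Q)})"
  define T where "T x = restrict (\<lambda>e. \<Sum>i\<in>I. x i * c e i) E" for x
  have TX: "T ` X \<subseteq> Y"
  proof -
    have "(\<Sum>i\<in>I. x i * c e i) \<in> {- int (h * Q)..int (h * Q)}" if x: "x \<in> X" and e: "e \<in> E" for x e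
    proof -
      have "\<bar>x i * c e i\<bar> \<le> int Q * int C" if "i \<in> I" for i
        unfolding abs_mult using x that bound[OF e that]
        by (intro mult_mono) (auto simp: X_def PiE_def Pi_def)
      then have "(\<Sum>i\<in>I. \<bar>x i * c e i\<bar>) \<le> (\<Sum>i\<in>I. int Q * int C)" by (intro sum_mono)
      also have "\<dots> = int (h * Q)" by (simp add: h_def)
      finally have "\<bar>\<Sum>i\<in>I. x i * c e i\<bar> \<le> int (h * Q)"
        using sum_abs[of "\<lambda>i. x i * c e i" I] by linarith
      then show ?thesis unfolding atLeastAtMost_iff by linarith
    qed
    then show ?thesis
      unfolding T_def Y_def by (auto intro!: restrict_PiE_iff[THEN iffD2])
  qed
  have finY: "finite Y" using fin by (simp add: Y_def finite_PiE)
  have finX: "finite X" using fin by (simp add: X_def finite_PiE)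
  have "card {- int (h * Q)..int (h * Q)} = Q\<^sup>2 + 1"
  proof -
    have "int (h * Q) + 1 + int (h * Q) = int (Q\<^sup>2 + 1)"
      by (simp add: Q_def power2_eq_square)
    then show ?thesis by (simp del: of_nat_mult of_nat_power of_nat_add)
  qed
  then have "card Y = (Q\<^sup>2 + 1) ^ card E"
    unfolding Y_def using fin by (subst card_PiE) auto
  also have "\<dots> < (Q + 1) ^ card I"
  proof (cases "card E = 0")
    case True
    have "1 < (Q + 1) ^ card I"
      using h1 fin ne by (intro one_less_power) (auto simp: Q_def card_gt_0_iff)
    then show ?thesis using True by simp
  next
    case False
    have "(Q\<^sup>2 + 1) ^ card E < ((Q + 1)\<^sup>2) ^ card E"
      using False h1 by (intro power_strict_mono) (auto simp: Q_def power2_eq_square)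
    also have "\<dots> = (Q + 1) ^ (2 * card E)" by (simp only: power_mult)
    also have "\<dots> \<le> (Q + 1) ^ card I" using card by (intro power_increasing) auto
    finally show ?thesis .
  qed
  also have "(Q + 1) ^ card I = card X"
    unfolding X_def using fin by (simp add: card_PiE nat_add_distrib add.commute)
  finally have "card (T ` X) < card X" using card_mono[OF finY TX] by linarith
  then have "\<not> inj_on T X" using pigeonhole by blast
  then obtain x y where xy: "x \<in> X" "y \<in> X" "x \<noteq> y" "T x = T y" unfolding inj_on_def by blast
  show thesis
  proof (rule that[of "\<lambda>i. x i - y i"])
    show "\<exists>i\<in>I. x i - y i \<noteq> 0"
    proof (rule ccontr)
      assume "\<not> ?thesis"
      then have "x = y" using xy(1,2) unfolding X_def by (intro PiE_ext) auto
      then show False using xy by simp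
    qed
    show "\<bar>x i - y i\<bar> \<le> int (2 * card I * C)" if "i \<in> I" for i
    proof -
      have "x i \<in> {0..int Q}" "y i \<in> {0..int Q}" using xy that by (auto simp: X_def)
      then have "\<bar>x i - y i\<bar> \<le> int Q" by auto
      also have "int Q = int (2 * card I * C)" by (simp add: Q_def h_def)
      finally show ?thesis .
    qed
    show "(\<Sum>i\<in>I. (x i - y i) * c e i) = 0" if "e \<in> E" for e
      using fun_cong[OF xy(4), of e] that by (simp add: T_def left_diff_distrib sum_subtractf)
  qed
qed

lemma sum_digits:
  assumes "c < L ^ M" "L > 0"
  shows "(\<Sum>i<M. (c div L ^ i mod L) * L ^ i) = (c::nat)"
  using assms
proof (induction M arbitrary: c)
  case 0
  then show ?case by simp
next
  case (Suc M)
  have "c div L < L ^ M" using Suc.prems by (simp add: less_mult_imp_div_less mult.commute)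
  then have "(\<Sum>i<M. (c div L div L ^ i mod L) * L ^ i) = c div L" using Suc by blast
  then have "L * (\<Sum>i<M. (c div L div L ^ i mod L) * L ^ i) = L * (c div L)" by simp
  then have "(\<Sum>i<M. (c div L ^ Suc i mod L) * L ^ Suc i) = L * (c div L)"
    unfolding sum_distrib_left by (simp add: div_mult2_eq mult_ac)
  then show ?case by (simp only: sum.lessThan_Suc_shift) simp
qed

text \<open>The exponent vector of the products below consists of the base-\<open>L\<close> digits of \<open>c\<close>, so that the
  product takes the value \<open>\<epsilon>\<^sup>c\<close> if the \<open>f i\<close> take the values \<open>\<epsilon> ^ (L ^ i)\<close>.\<close>

lemma algebraic_dependence:
  fixes f :: "nat \<Rightarrow> (nat \<Rightarrow> real) \<Rightarrow> real"
  assumes f: "\<And>i. i < M \<Longrightarrow> int_poly_fun M d C (f i)" and l: "l < M"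
    and d: "d \<ge> 1" and C: "C \<ge> 1"
    and L: "L = 2 * (2 * M * d) ^ M" and B: "B = M * d * L"
  obtains A :: "nat \<Rightarrow> nat \<Rightarrow> int" where
    "\<exists>c<L ^ M. \<exists>b<B. A c b \<noteq> 0"
    "\<And>c b. c < L ^ M \<Longrightarrow> b < B \<Longrightarrow> \<bar>A c b\<bar> \<le> int (2 * (L ^ M * B) * C ^ (M * L))"
    "\<And>v. (\<Sum>c<L ^ M. \<Sum>b<B. of_int (A c b) * ((\<Prod>i<M. f i v ^ (c div L ^ i mod L)) * v l ^ b)) = 0"
proof -
  have M: "M > 0" using l by simp
  have Lpos: "L > 0" using M d by (simp add: L)
  have Bpos: "B > 0" using M d Lpos by (simp add: B)
  \<comment> \<open>A product of powers of the \<open>f i\<close> has degree at most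
    \<open>M * d * L\<close> per variable, and the power of \<open>v l\<close> adds at most
    \<open>B - 1 = M * d * L - 1\<close>.\<close>
  define D where "D = 2 * M * d * L - 1"
  define I where "I = {..<L ^ M} \<times> {..<B}"
  define \<phi> where "\<phi> x v = (\<Prod>i<M. f i v ^ (fst x div L ^ i mod L)) * v l ^ snd x" for x :: "nat \<times> nat" and v
  have \<phi>: "int_poly_fun M D (C ^ (M * L)) (\<phi> x)" if "x \<in> I" for x
  proof -
    let ?dg = "\<lambda>i. fst x div L ^ i mod L"
    have dg: "?dg i < L" for i using Lpos by simp
    have "int_poly_fun M ((\<Sum>i<M. ?dg i * d) + snd x * 1) ((\<Prod>i<M. C ^ ?dg i) * 1 ^ snd x) (\<phi> x)"
      unfolding \<phi>_def
      by (intro int_poly_fun_mult int_poly_fun_prod int_poly_fun_power f int_poly_fun_coord l) auto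
    moreover have "(\<Sum>i<M. ?dg i * d) + snd x * 1 \<le> D"
    proof -
      have "(\<Sum>i<M. ?dg i * d) \<le> (\<Sum>i<M. L * d)"
        using dg by (intro sum_mono mult_right_mono) (auto intro: less_imp_le)
      moreover have "snd x < B" using that by (auto simp: I_def)
      ultimately show ?thesis by (simp add: D_def B algebra_simps)
    qed
    moreover have "(\<Prod>i<M. C ^ ?dg i) * 1 ^ snd x \<le> C ^ (M * L)"
    proof -
      have "(\<Prod>i<M. C ^ ?dg i) \<le> (\<Prod>i<M. C ^ L)"
        using dg C by (intro prod_mono) (auto intro!: power_increasing[OF less_imp_le])
      also have "\<dots> = C ^ (M * L)" by (simp add: power_mult[symmetric] mult.commute)
      finally show ?thesis by simp
    qed
    ultimately show ?thesis by (rule int_poly_fun_mono)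
  qed
  then have "\<forall>x\<in>I. \<exists>c :: (nat \<Rightarrow> nat) \<Rightarrow> int.
        (\<forall>v. \<phi> x v = (\<Sum>\<alpha>\<in>exps M D. of_int (c \<alpha>) * monom_fun M \<alpha> v)) \<and>
        (\<Sum>\<alpha>\<in>exps M D. \<bar>c \<alpha>\<bar>) \<le> int (C ^ (M * L))"
    unfolding int_poly_fun_def by blast
  then obtain k :: "nat \<times> nat \<Rightarrow> (nat \<Rightarrow> nat) \<Rightarrow> int" where
    k: "\<And>x v. x \<in> I \<Longrightarrow> \<phi> x v = (\<Sum>\<alpha>\<in>exps M D. of_int (k x \<alpha>) * monom_fun M \<alpha> v)"
    and kb: "\<And>x. x \<in> I \<Longrightarrow> (\<Sum>\<alpha>\<in>exps M D. \<bar>k x \<alpha>\<bar>) \<le> int (C ^ (M * L))"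
    by (elim bchoice[THEN exE]) blast
  have cardI: "card I = L ^ M * B" by (simp add: I_def)
  \<comment> \<open>This explains the choice of \<open>L\<close>: twice the number of monomials is
    \<open>2 * (2 * M * d * L) ^ M = L * L ^ M\<close>, which is at most the number
    \<open>L ^ M * B\<close> of unknown coefficients.\<close>
  have cardE: "2 * card (exps M D) \<le> card I"
  proof -
    have "D + 1 = (2 * M * d) * L" using M d Lpos by (simp add: D_def)
    then have "card (exps M D) = (2 * M * d) ^ M * L ^ M"
      unfolding card_exps by (simp only: power_mult_distrib)
    then have "2 * card (exps M D) = L * L ^ M" by (simp only: L)
    also have "\<dots> \<le> L ^ M * B" using M d by (simp add: B)
    finally show ?thesis by (simp add: cardI)
  qed
  have kb': "\<bar>k x \<alpha>\<bar> \<le> int (C ^ (M * L))" if "\<alpha> \<in> exps M D" "x \<in> I" for \<alpha> x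
    using member_le_sum[of \<alpha> "exps M D" "\<lambda>\<alpha>. \<bar>k x \<alpha>\<bar>"] kb[OF that(2)] that(1) by simp
  have ne: "I \<noteq> {}" using Lpos Bpos by (auto simp: I_def lessThan_empty_iff)
  have finI: "finite I" by (simp add: I_def)
  have C1: "1 \<le> C ^ (M * L)" using C by simp
  obtain A where A: "\<exists>x\<in>I. A x \<noteq> 0" "\<And>x. x \<in> I \<Longrightarrow> \<bar>A x\<bar> \<le> int (2 * card I * C ^ (M * L))"
    "\<And>\<alpha>. \<alpha> \<in> exps M D \<Longrightarrow> (\<Sum>x\<in>I. A x * k x \<alpha>) = 0"
    using siegel_pigeonhole[OF finI finite_exps ne C1, of M D "\<lambda>\<alpha> x. k x \<alpha>", OF kb' cardE] by blast
  have "(\<Sum>x\<in>I. of_int (A x) * \<phi> x v) = 0" for v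
  proof -
    have "(\<Sum>x\<in>I. of_int (A x) * \<phi> x v)
        = (\<Sum>x\<in>I. \<Sum>\<alpha>\<in>exps M D. of_int (A x * k x \<alpha>) * monom_fun M \<alpha> v)"
      by (intro sum.cong refl) (simp add: k sum_distrib_left mult.assoc)
    also have "\<dots> = (\<Sum>\<alpha>\<in>exps M D. \<Sum>x\<in>I. of_int (A x * k x \<alpha>) * monom_fun M \<alpha> v)"
      by (rule sum.swap)
    also have "\<dots> = (\<Sum>\<alpha>\<in>exps M D. of_int (\<Sum>x\<in>I. A x * k x \<alpha>) * monom_fun M \<alpha> v)"
      by (simp add: sum_distrib_right)
    also have "\<dots> = 0" by (simp add: A(3) del: of_int_sum)
    finally show ?thesis .
  qed
  then have *: "(\<Sum>c<L ^ M. \<Sum>b<B. of_int (A (c, b)) * ((\<Prod>i<M. f i v ^ (c div L ^ i mod L)) * v l ^ b)) = 0" for v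
    by (simp add: I_def \<phi>_def sum.cartesian_product case_prod_unfold)
  show thesis
  proof (rule that[of "\<lambda>c b. A (c, b)"])
    show "\<exists>c<L ^ M. \<exists>b<B. A (c, b) \<noteq> 0" using A(1) by (auto simp: I_def)
    show "\<bar>A (c, b)\<bar> \<le> int (2 * (L ^ M * B) * C ^ (M * L))" if "c < L ^ M" "b < B" for c b
      using A(2)[of "(c, b)"] that unfolding cardI by (auto simp: I_def)
  qed (fact *)
qed

text \<open>Cauchy's root bound. The leading coefficient, a nonzero integer, is at least 1 in
  absolute value, so beyond \<open>1 + X\<close> the leading term exceeds the geometric sum of all
  others.\<close>

lemma int_poly_root_bound:
  fixes P :: "nat \<Rightarrow> int" and z :: real
  assumes nz: "\<exists>b<B. P b \<noteq> 0" and bd: "\<And>b. b < B \<Longrightarrow> \<bar>P b\<bar> \<le> int X"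
    and root: "(\<Sum>b<B. of_int (P b) * z ^ b) = 0"
  shows "\<bar>z\<bar> \<le> 1 + real X"
proof (rule ccontr)
  assume "\<not> ?thesis"
  then have big: "\<bar>z\<bar> > 1 + real X" by simp
  define k where "k = Max {b. b < B \<and> P b \<noteq> 0}"
  have fin: "finite {b. b < B \<and> P b \<noteq> 0}" by simp
  have kmem: "k < B" "P k \<noteq> 0"
    using Max_in[OF fin] nz unfolding k_def by auto
  have above: "P b = 0" if "b < B" "b > k" for b
    using Max_ge[OF fin, of b] that unfolding k_def by fastforce
  have "(\<Sum>b<B. of_int (P b) * z ^ b) = (\<Sum>b<Suc k. of_int (P b) * z ^ b)"
    using kmem above by (intro sum.mono_neutral_right) auto
  then have "of_int (P k) * z ^ k = - (\<Sum>b<k. of_int (P b) * z ^ b)" using root by simp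
  then have "\<bar>of_int (P k) * z ^ k\<bar> = \<bar>\<Sum>b<k. of_int (P b) * z ^ b\<bar>" by simp
  also have "\<dots> \<le> (\<Sum>b<k. real X * \<bar>z\<bar> ^ b)"
  proof (intro order_trans[OF sum_abs] sum_mono)
    fix b assume "b \<in> {..<k}"
    then have "\<bar>P b\<bar> \<le> int X" using bd kmem by auto
    then have "\<bar>real_of_int (P b)\<bar> \<le> real X" by linarith
    then show "\<bar>real_of_int (P b) * z ^ b\<bar> \<le> real X * \<bar>z\<bar> ^ b"
      by (simp add: abs_mult power_abs mult_right_mono)
  qed
  also have "\<dots> = real X * ((\<bar>z\<bar> ^ k - 1) / (\<bar>z\<bar> - 1))"
    using big by (simp add: sum_distrib_left[symmetric] geometric_sum)
  also have "\<dots> \<le> \<bar>z\<bar> ^ k - 1"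
  proof -
    have "\<bar>z\<bar> ^ k \<ge> 1" using big by (intro one_le_power) simp
    then have "real X * (\<bar>z\<bar> ^ k - 1) \<le> (\<bar>z\<bar> - 1) * (\<bar>z\<bar> ^ k - 1)"
      using big by (intro mult_right_mono) auto
    then show ?thesis using big by (simp add: field_simps)
  qed
  finally have "\<bar>of_int (P k) * z ^ k\<bar> < \<bar>z\<bar> ^ k" by simp
  moreover have "1 * \<bar>z\<bar> ^ k \<le> \<bar>real_of_int (P k)\<bar> * \<bar>z\<bar> ^ k"
  proof (intro mult_right_mono)
    show "1 \<le> \<bar>real_of_int (P k)\<bar>" using kmem(2) by linarith
  qed simp
  ultimately show False by (simp add: abs_mult power_abs)
qed

lemma elimination_bound:
  fixes f :: "nat \<Rightarrow> (nat \<Rightarrow> real) \<Rightarrow> real" and \<epsilon> :: "nat \<Rightarrow> real" and v :: "nat \<Rightarrow> nat \<Rightarrow> real"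
  assumes f: "\<And>i. i < M \<Longrightarrow> int_poly_fun M d C (f i)" and l: "l < M"
    and d: "d \<ge> 1" and C: "C \<ge> 1"
    and L: "L = 2 * (2 * M * d) ^ M" and B: "B = M * d * L"
    and eps: "\<And>k. \<epsilon> k > 0" "\<epsilon> \<longlonglongrightarrow> 0"
    and sol: "\<And>i k. i < M \<Longrightarrow> f i (v k) = \<epsilon> k ^ (L ^ i)"
    and lim: "(\<lambda>k. v k l) \<longlonglongrightarrow> z"
  shows "\<bar>z\<bar> \<le> 1 + real (2 * (L ^ M * B) * C ^ (M * L))"
proof -
  obtain A :: "nat \<Rightarrow> nat \<Rightarrow> int" where
    A: "\<exists>c<L ^ M. \<exists>b<B. A c b \<noteq> 0"
    "\<And>c b. c < L ^ M \<Longrightarrow> b < B \<Longrightarrow> \<bar>A c b\<bar> \<le> int (2 * (L ^ M * B) * C ^ (M * L))"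
    "\<And>v. (\<Sum>c<L ^ M. \<Sum>b<B. of_int (A c b) * ((\<Prod>i<M. f i v ^ (c div L ^ i mod L)) * v l ^ b)) = 0"
    using algebraic_dependence[of M d C f l L B, OF f l d C L B] by blast
  have Lpos: "L > 0" using l d by (simp add: L)
  define c0 where "c0 = (LEAST c. c < L ^ M \<and> (\<exists>b<B. A c b \<noteq> 0))"
  have c0: "c0 < L ^ M" "\<exists>b<B. A c0 b \<noteq> 0"
    using LeastI_ex[of "\<lambda>c. c < L ^ M \<and> (\<exists>b<B. A c b \<noteq> 0)"] A(1) unfolding c0_def by auto
  have below: "A c b = 0" if "c < c0" "b < B" for c b
    using not_less_Least[of c "\<lambda>c. c < L ^ M \<and> (\<exists>b<B. A c b \<noteq> 0)"] that c0 unfolding c0_def by auto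
  \<comment> \<open>All rows below \<open>c0\<close> vanish, so the relation is
    \<open>\<epsilon> k ^ c0 * S k = 0\<close> and the factor can be cancelled before passing to the
    limit.\<close>
  define S where "S k = (\<Sum>c\<in>{c0..<L ^ M}. \<Sum>b<B. of_int (A c b) * (\<epsilon> k ^ (c - c0) * v k l ^ b))" for k
  have "S k = 0" for k
  proof -
    have pr: "(\<Prod>i<M. f i (v k) ^ (c div L ^ i mod L)) = \<epsilon> k ^ c" if "c < L ^ M" for c
    proof -
      have "(\<Prod>i<M. f i (v k) ^ (c div L ^ i mod L)) = (\<Prod>i<M. \<epsilon> k ^ ((c div L ^ i mod L) * L ^ i))"
        by (intro prod.cong refl) (simp add: sol power_mult[symmetric] mult.commute)
      also have "\<dots> = \<epsilon> k ^ c" using sum_digits[OF that Lpos] by (simp add: power_sum[symmetric])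
      finally show ?thesis .
    qed
    have "0 = (\<Sum>c<L ^ M. \<Sum>b<B. of_int (A c b) * (\<epsilon> k ^ c * v k l ^ b))"
    proof -
      have inner: "(\<Sum>b<B. of_int (A c b) * ((\<Prod>i<M. f i (v k) ^ (c div L ^ i mod L)) * v k l ^ b))
          = (\<Sum>b<B. of_int (A c b) * (\<epsilon> k ^ c * v k l ^ b))" if "c < L ^ M" for c
        by (simp only: pr[OF that])
      show ?thesis unfolding A(3)[of "v k", symmetric] by (rule sum.cong[OF refl], rule inner) simp
    qed
    also have "\<dots> = (\<Sum>c\<in>{c0..<L ^ M}. \<Sum>b<B. of_int (A c b) * (\<epsilon> k ^ c * v k l ^ b))"
      by (intro sum.mono_neutral_right) (auto simp: below not_le)
    also have "\<dots> = \<epsilon> k ^ c0 * S k"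
    proof -
      have "of_int (A c b) * (\<epsilon> k ^ c * y) = \<epsilon> k ^ c0 * (of_int (A c b) * (\<epsilon> k ^ (c - c0) * y))"
        if "c \<in> {c0..<L ^ M}" for c b y
      proof -
        have "\<epsilon> k ^ c = \<epsilon> k ^ c0 * \<epsilon> k ^ (c - c0)" using that by (simp flip: power_add)
        then show ?thesis by (simp only: mult_ac)
      qed
      note eq = this
      show ?thesis
        unfolding S_def sum_distrib_left by (rule sum.cong[OF refl], rule sum.cong[OF refl], rule eq)
    qed
    finally show ?thesis using eps(1)[of k] by simp
  qed
  then have S_zero: "S = (\<lambda>_. 0)" by auto
  \<comment> \<open>In the limit \<open>0 ^ (c - c0)\<close> is 1 for \<open>c = c0\<close> and 0
    otherwise, so exactly the lowest nonzero row remains.\<close>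
  have "S \<longlonglongrightarrow> (\<Sum>c\<in>{c0..<L ^ M}. \<Sum>b<B. of_int (A c b) * (0 ^ (c - c0) * z ^ b))"
    unfolding S_def by (intro tendsto_intros eps lim)
  then have "(\<Sum>c\<in>{c0..<L ^ M}. \<Sum>b<B. of_int (A c b) * (0 ^ (c - c0) * z ^ b)) = 0"
    unfolding S_zero by (rule LIMSEQ_unique[OF _ tendsto_const])
  also have "(\<Sum>c\<in>{c0..<L ^ M}. \<Sum>b<B. of_int (A c b) * (0 ^ (c - c0) * z ^ b))
      = (\<Sum>c\<in>{c0}. \<Sum>b<B. of_int (A c b) * (0 ^ (c - c0) * z ^ b))"
  proof (intro sum.mono_neutral_right ballI)
    show "{c0} \<subseteq> {c0..<L ^ M}" using c0 by auto
    show "(\<Sum>b<B. of_int (A c b) * (0 ^ (c - c0) * z ^ b)) = 0" if "c \<in> {c0..<L ^ M} - {c0}" for c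
    proof -
      have "(0::real) ^ (c - c0) = 0" using that by simp
      then show ?thesis by (simp only: mult_zero_left mult_zero_right sum.neutral_const)
    qed
  qed simp
  finally have "(\<Sum>b<B. of_int (A c0 b) * z ^ b) = 0" by simp
  then show ?thesis using int_poly_root_bound[of B "A c0"] c0 A(2)[OF c0(1)] by blast
qed

section \<open>Size of the explicit bound\<close>

definition root_bound :: "nat \<Rightarrow> nat \<Rightarrow> nat \<Rightarrow> nat" where
  "root_bound M d C =
     (let L = 2 * (2 * M * d) ^ M in 1 + 2 * (L ^ M * (M * d * L)) * C ^ (M * L))"

lemma root_bound_mono:
  assumes "1 \<le> M" "M \<le> M'" "1 \<le> d" "1 \<le> C" "C \<le> C'"
  shows "root_bound M d C \<le> root_bound M' d C'"
proof -
  define L where "L = 2 * (2 * M * d) ^ M"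
  define L' where "L' = 2 * (2 * M' * d) ^ M'"
  have "(2 * M * d) ^ M \<le> (2 * M' * d) ^ M" using assms by (intro power_mono mult_le_mono) auto
  also have "\<dots> \<le> (2 * M' * d) ^ M'" using assms by (intro power_increasing) auto
  finally have L: "L \<le> L'" by (simp add: L_def L'_def)
  have "0 < L" unfolding L_def using assms by (intro mult_pos_pos zero_less_power) auto
  then have L1: "1 \<le> L" "1 \<le> L'" using L by auto
  have "L ^ M \<le> L' ^ M" using L by (intro power_mono) auto
  also have "\<dots> \<le> L' ^ M'" using assms L1 by (intro power_increasing) auto
  finally have LM: "L ^ M \<le> L' ^ M'" .
  have "C ^ (M * L) \<le> C' ^ (M * L)" using assms by (intro power_mono) auto
  also have "\<dots> \<le> C' ^ (M' * L')" using assms L by (intro power_increasing mult_le_mono) auto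
  finally have CM: "C ^ (M * L) \<le> C' ^ (M' * L')" .
  have "2 * (L ^ M * (M * d * L)) * C ^ (M * L) \<le> 2 * (L' ^ M' * (M' * d * L')) * C' ^ (M' * L')"
    using assms LM CM L by (intro mult_le_mono order_refl) auto
  then show ?thesis by (simp add: root_bound_def L_def L'_def Let_def)
qed

text \<open>Origin of the exponent \<open>33 * n\<close>, with \<open>t = n * r\<close>. From
  \<open>2 * M * d \<le> t ^ 4\<close> and \<open>M \<le> 6 * n\<close> comes
  \<open>L \<le> t ^ (25 * n)\<close>. With \<open>e = 25 * n + 5\<close>, where 5 covers the
  factors \<open>t ^ 2\<close> and \<open>M \<le> t ^ 3\<close>, each of the three factors in
  \<open>root_bound\<close> is at most \<open>2 ^ (\<tau> * t ^ e)\<close>. Combining them adds 2 to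
  \<open>e\<close>, the \<open>r\<close>-th power 1, absorbing \<open>n + 1\<close> another 1, and
  \<open>25 * n + 9 \<le> 33 * n\<close>.\<close>

lemma root_bound_estimate:
  fixes n r \<tau> :: nat
  assumes n: "2 \<le> n" and r: "2 \<le> r" and \<tau>: "1 \<le> \<tau>"
  shows "(n + 1) * root_bound (3 * n + 6) (r + 1) ((3 * n + 7) * 2 ^ \<tau> * r) ^ r
      \<le> 2 ^ (\<tau> * (n * r) ^ (33 * n))"
proof -
  define t where "t = n * r"
  have t4: "4 \<le> t" using mult_le_mono[OF n r] by (simp add: t_def)
  have nt: "n \<le> t" "r \<le> t" using n r by (auto simp: t_def)
  have pow: "t ^ i \<le> t ^ j" if "i \<le> j" for i j using that t4 by (intro power_increasing) auto
  have p1: "t \<le> 2 ^ t" by (rule less_imp_le[OF less_exp])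
  have c: "4 * x \<le> t * x" for x using t4 by simp
  have t2: "16 \<le> t\<^sup>2" using mult_le_mono[OF t4 t4] by (simp add: power2_eq_square)
  have t3: "64 \<le> t ^ 3" using mult_le_mono[OF t4 t2] by (simp add: power3_eq_cube power2_eq_square)
  define M where "M = 3 * n + 6"
  have M: "M \<le> 6 * n" using n by (simp add: M_def)
  have Mt: "M \<le> t ^ 3"
  proof -
    have "6 * n \<le> t\<^sup>2 * t" using t2 nt by (intro mult_le_mono) auto
    then show ?thesis using M by (simp add: power3_eq_cube power2_eq_square)
  qed
  define d where "d = r + 1"
  have Md: "2 * M * d \<le> 24 * t"
  proof -
    have "2 * M * d \<le> 2 * (6 * n) * (2 * r)" using M r by (intro mult_le_mono) (auto simp: d_def)
    then show ?thesis by (simp add: t_def)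
  qed
  define L where "L = 2 * (2 * M * d) ^ M"
  have L: "L \<le> t ^ (25 * n)"
  proof -
    have "24 * t \<le> t ^ 3 * t" using t3 by (intro mult_le_mono) auto
    also have "\<dots> = t ^ 4" by (simp add: power4_eq_xxxx power3_eq_cube)
    finally have "2 * M * d \<le> t ^ 4" using Md by linarith
    then have "(2 * M * d) ^ M \<le> (t ^ 4) ^ M" by (intro power_mono) auto
    also have "\<dots> \<le> (t ^ 4) ^ (6 * n)" using M t4 by (intro power_increasing) auto
    also have "\<dots> = t ^ (24 * n)" by (simp flip: power_mult)
    finally have "L \<le> t * t ^ (24 * n)" unfolding L_def using t4 by (intro mult_le_mono) auto
    also have "\<dots> = t ^ Suc (24 * n)" by simp
    also have "\<dots> \<le> t ^ (25 * n)" using n by (intro pow) auto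
    finally show ?thesis .
  qed
  define e where "e = 25 * n + 5"
  have LM: "L ^ M \<le> 2 ^ t ^ e"
  proof -
    have "L ^ M \<le> (t ^ (25 * n)) ^ M" using L by (intro power_mono) auto
    also have "\<dots> \<le> ((2 ^ t) ^ (25 * n)) ^ M" using p1 by (intro power_mono) auto
    also have "\<dots> = 2 ^ (t * (25 * n) * M)" by (simp add: power_mult)
    also have "\<dots> \<le> 2 ^ t ^ e"
    proof (intro power_increasing)
      have "25 * n \<le> t ^ 3 * t" using t3 nt by (intro mult_le_mono) auto
      then have "t * (25 * n) * M \<le> t * (t ^ 3 * t) * t ^ 3"
        by (rule mult_le_mono[OF mult_le_mono[OF order_refl] Mt])
      also have "\<dots> = t ^ 8" by (simp add: eval_nat_numeral mult_ac)
      also have "\<dots> \<le> t ^ e" using n by (intro pow) (simp add: e_def)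
      finally show "t * (25 * n) * M \<le> t ^ e" .
    qed simp
    finally show ?thesis .
  qed
  have MdL: "M * d * L \<le> 2 ^ t ^ e"
  proof -
    have "M * d \<le> 24 * t" using Md by simp
    then have "M * d * L \<le> (24 * t) * t ^ (25 * n)" using L by (rule mult_le_mono)
    also have "\<dots> \<le> (t ^ 3 * t) * t ^ (25 * n)" using t3 by (intro mult_le_mono order_refl) simp
    also have "\<dots> = t ^ (25 * n + 4)" by (simp add: power_add eval_nat_numeral mult_ac)
    also have "\<dots> \<le> t ^ e" by (intro pow) (simp add: e_def)
    also have "\<dots> \<le> 2 ^ t ^ e" by (rule less_imp_le[OF less_exp])
    finally show ?thesis .
  qed
  define C where "C = (3 * n + 7) * 2 ^ \<tau> * r"
  have CL: "C ^ (M * L) \<le> 2 ^ (\<tau> * t ^ e)"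
  proof -
    have "(3 * n + 7) * r \<le> (8 * n) * r" using n by (intro mult_le_mono) auto
    also have "\<dots> = 8 * t" by (simp add: t_def)
    also have "\<dots> \<le> 2 ^ 3 * 2 ^ t" using p1 by (intro mult_le_mono) auto
    also have "\<dots> = 2 ^ (t + 3)" by (simp add: power_add)
    finally have "(3 * n + 7) * r * 2 ^ \<tau> \<le> 2 ^ (t + 3) * 2 ^ \<tau>" by (rule mult_le_mono1)
    then have "C \<le> 2 ^ (t + 3) * 2 ^ \<tau>" by (simp only: C_def mult_ac)
    also have "\<dots> = 2 ^ (t + 3 + \<tau>)" by (simp add: power_add)
    also have "\<dots> \<le> 2 ^ (\<tau> * t\<^sup>2)"
    proof (intro power_increasing)
      have "t + 3 + \<tau> \<le> \<tau> * (t + 4)" using mult_le_mono1[OF \<tau>, of "t + 3"] by (simp add: algebra_simps)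
      also have "\<dots> \<le> \<tau> * (t * t)"
      proof (intro mult_le_mono order_refl)
        have "t + 4 \<le> 4 * t" using t4 by simp
        then show "t + 4 \<le> t * t" using c[of t] by linarith
      qed
      finally show "t + 3 + \<tau> \<le> \<tau> * t\<^sup>2" by (simp add: power2_eq_square)
    qed simp
    finally have "C ^ (M * L) \<le> (2 ^ (\<tau> * t\<^sup>2)) ^ (M * L)" by (intro power_mono) auto
    also have "\<dots> = 2 ^ (\<tau> * t\<^sup>2 * (M * L))" by (simp add: power_mult)
    also have "\<dots> \<le> 2 ^ (\<tau> * t ^ e)"
    proof (intro power_increasing)
      have "\<tau> * t\<^sup>2 * (M * L) \<le> \<tau> * t\<^sup>2 * (t ^ 3 * t ^ (25 * n))"
        using Mt L by (intro mult_le_mono) auto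
      also have "\<dots> = \<tau> * t ^ e" by (simp add: e_def power_add eval_nat_numeral mult_ac)
      finally show "\<tau> * t\<^sup>2 * (M * L) \<le> \<tau> * t ^ e" .
    qed simp
    finally show ?thesis .
  qed
  have te: "t \<le> t ^ e" using pow[of 1 e] by (simp add: e_def)
  have rb: "root_bound M d C \<le> 2 ^ (\<tau> * t ^ (e + 2))"
  proof -
    have "2 * (L ^ M * (M * d * L)) * C ^ (M * L) \<le> 2 * (2 ^ t ^ e * 2 ^ t ^ e) * 2 ^ (\<tau> * t ^ e)"
      using LM MdL CL by (intro mult_le_mono) auto
    also have "\<dots> = 2 ^ Suc (t ^ e + t ^ e + \<tau> * t ^ e)" by (simp add: power_add)
    finally have "root_bound M d C \<le> 1 + 2 ^ Suc (t ^ e + t ^ e + \<tau> * t ^ e)"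
      by (simp add: root_bound_def L_def Let_def)
    also have "\<dots> \<le> 2 ^ Suc (Suc (t ^ e + t ^ e + \<tau> * t ^ e))" by simp
    also have "\<dots> \<le> 2 ^ (\<tau> * t ^ (e + 2))"
    proof (intro power_increasing)
      have "t ^ e \<le> \<tau> * t ^ e" using \<tau> by simp
      then have "Suc (Suc (t ^ e + t ^ e + \<tau> * t ^ e)) \<le> 4 * (\<tau> * t ^ e)"
        using te t4 by linarith
      also have "\<dots> \<le> (t * t) * (\<tau> * t ^ e)"
        using t2 by (intro mult_le_mono1) (simp add: power2_eq_square)
      finally show "Suc (Suc (t ^ e + t ^ e + \<tau> * t ^ e)) \<le> \<tau> * t ^ (e + 2)" by (simp add: power_add mult_ac power2_eq_square)
    qed simp
    finally show ?thesis .
  qed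
  have "(n + 1) * root_bound M d C ^ r \<le> 2 ^ t * (2 ^ (\<tau> * t ^ (e + 2))) ^ r"
  proof (intro mult_le_mono power_mono rb)
    have "n * 2 \<le> t" unfolding t_def using r by (rule mult_le_mono2)
    then have "n + 1 \<le> t" using n by simp
    then show "n + 1 \<le> 2 ^ t" using p1 by linarith
  qed simp
  also have "\<dots> = 2 ^ (t + \<tau> * t ^ (e + 2) * r)" by (simp add: power_add power_mult)
  also have "\<dots> \<le> 2 ^ (\<tau> * t ^ (33 * n))"
  proof (intro power_increasing)
    have "t \<le> t ^ (e + 3)" using pow[of 1 "e + 3"] by simp
    also have "\<dots> \<le> \<tau> * t ^ (e + 3)" using \<tau> by simp
    finally have "t + \<tau> * t ^ (e + 2) * r \<le> \<tau> * t ^ (e + 3) + \<tau> * t ^ (e + 2) * t"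
      using nt by (intro add_mono mult_le_mono) auto
    also have "\<dots> = 2 * (\<tau> * t ^ (e + 3))"
    proof -
      have "t ^ (e + 3) = t ^ (e + 2) * t" by (simp add: power_add eval_nat_numeral)
      then show ?thesis by (simp only: mult_2 mult.assoc)
    qed
    also have "\<dots> \<le> t * (\<tau> * t ^ (e + 3))" using t4 by (intro mult_le_mono1) simp
    also have "\<dots> = \<tau> * t ^ (e + 4)" by (simp add: eval_nat_numeral mult_ac)
    also have "\<dots> \<le> \<tau> * t ^ (33 * n)" using n by (intro mult_le_mono2 pow) (simp add: e_def)
    finally show "t + \<tau> * t ^ (e + 2) * r \<le> \<tau> * t ^ (33 * n)" .
  qed simp
  finally show ?thesis by (simp add: M_def d_def C_def t_def)
qed

section \<open>Extremal coordinates of polynomial systems\<close>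

text \<open>Tychonoff's theorem. Points are functions on all of \<open>nat\<close>; coordinates
  beyond the dimension will be pinned to \<open>{0}\<close>.\<close>

lemma compact_Pi_UNIV:
  fixes S :: "'i \<Rightarrow> 'a :: topological_space set"
  assumes "\<And>i. compact (S i)"
  shows "compact (Pi UNIV S)"
  using compactin_PiE[of "\<lambda>_. euclidean" UNIV S] assms
  by (simp add: euclidean_product_topology PiE_UNIV_domain flip: compactin_euclidean_iff)

lemma tendsto_coordinate:
  fixes w :: "nat \<Rightarrow> 'i \<Rightarrow> real"
  assumes "w \<longlonglongrightarrow> l"
  shows "(\<lambda>k. w k i) \<longlonglongrightarrow> l i"
  using continuous_on_tendsto_compose[OF continuous_on_product_coordinates[of i] assms] by simp

lemma bounded_above_on_compact:
  fixes h :: "'i \<Rightarrow> 'a :: topological_space \<Rightarrow> real"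
  assumes "compact X" "\<And>j. j \<in> J \<Longrightarrow> continuous_on X (h j)" "finite J"
  obtains G where "G \<ge> 1" "\<And>u j. u \<in> X \<Longrightarrow> j \<in> J \<Longrightarrow> h j u \<le> G"
proof (cases "X = {}")
  case True
  then show thesis using that[of 1] by auto
next
  case False
  have "continuous_on X (\<lambda>u. \<Sum>j\<in>J. \<bar>h j u\<bar>)"
    using assms by (intro continuous_intros) auto
  then obtain x where x: "x \<in> X" "\<And>u. u \<in> X \<Longrightarrow> (\<Sum>j\<in>J. \<bar>h j u\<bar>) \<le> (\<Sum>j\<in>J. \<bar>h j x\<bar>)"
    using continuous_attains_sup[OF assms(1) False] by blast
  show thesis
  proof (rule that[of "1 + (\<Sum>j\<in>J. \<bar>h j x\<bar>)"])
    show "1 \<le> 1 + (\<Sum>j\<in>J. \<bar>h j x\<bar>)" by (simp add: sum_nonneg)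
    show "h j u \<le> 1 + (\<Sum>j\<in>J. \<bar>h j x\<bar>)" if "u \<in> X" "j \<in> J" for u j
      using x(2)[OF that(1)] member_le_sum[of j J "\<lambda>j. \<bar>h j u\<bar>"] that(2) assms(3) by simp
  qed
qed

text \<open>All constraints have this separated form with a single exponent. A partial derivative
  then involves one coordinate only, and changing one coordinate changes the value by an explicit
  term.\<close>

definition sep_poly :: "nat \<Rightarrow> int \<Rightarrow> (nat \<Rightarrow> int) \<Rightarrow> nat \<Rightarrow> (nat \<Rightarrow> real) \<Rightarrow> real" where
  "sep_poly N a c k u = of_int a + (\<Sum>i<N. of_int (c i) * u i ^ k)"

lemma continuous_on_sep_poly [continuous_intros]: "continuous_on S (sep_poly N a c k)"
  unfolding sep_poly_def
  by (intro continuous_intros continuous_on_subset[OF continuous_on_product_coordinates]) auto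

lemma sep_poly_tendsto:
  assumes "\<And>i. (\<lambda>n. w n i) \<longlonglongrightarrow> l i"
  shows "(\<lambda>n. sep_poly N a c k (w n)) \<longlonglongrightarrow> sep_poly N a c k l"
  unfolding sep_poly_def by (intro tendsto_intros assms)

lemma sep_poly_upd:
  assumes "i < N"
  shows "sep_poly N a c k (w(i := s)) = sep_poly N a c k w + of_int (c i) * (s ^ k - w i ^ k)"
proof -
  have "(\<Sum>i'<N. of_int (c i') * (w(i := s)) i' ^ k)
      = (\<Sum>i'<N. of_int (c i') * w i' ^ k + (if i' = i then of_int (c i) * (s ^ k - w i ^ k) else 0))"
    by (intro sum.cong refl) (auto simp: algebra_simps)
  then show ?thesis using assms by (simp add: sep_poly_def sum.distrib)
qed

lemma int_poly_fun_sep_poly: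
  assumes "N \<le> M" "\<bar>a\<bar> \<le> int W" "\<And>i. i < N \<Longrightarrow> \<bar>c i\<bar> \<le> int W" "k \<le> d"
  shows "int_poly_fun M d (W + N * W) (sep_poly N a c k)"
proof -
  have "int_poly_fun M d (W + (\<Sum>i<N. W)) (\<lambda>v. of_int a + (\<Sum>i<N. of_int (c i) * v i ^ k))"
  proof (intro int_poly_fun_add int_poly_fun_sum)
    show "int_poly_fun M d W (\<lambda>v. of_int a)"
      using int_poly_fun_mono[OF int_poly_fun_const[of M 0 a]] assms(2) by simp
    fix i assume "i \<in> {..<N}"
    then have i: "i < N" "i < M" using assms(1) by auto
    have "int_poly_fun M (0 + k * 1) (nat \<bar>c i\<bar> * 1 ^ k) (\<lambda>v. of_int (c i) * v i ^ k)"
      by (intro int_poly_fun_mult int_poly_fun_const int_poly_fun_power int_poly_fun_coord i)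
    then show "int_poly_fun M d W (\<lambda>v. of_int (c i) * v i ^ k)"
      by (rule int_poly_fun_mono) (use assms(3)[OF i(1)] assms(4) in auto)
  qed simp
  then show ?thesis by (simp add: sep_poly_def[abs_def])
qed

text \<open>\<open>z\<close> is the index of the coordinate to be bounded. Coercivity is required
  for constraints relaxed by 1 and with only \<open>u z\<close> capped, so that all perturbed
  problems with \<delta> at most 1 live in one compact set.\<close>

locale sep_system =
  fixes N K :: nat and a :: "nat \<Rightarrow> int" and c :: "nat \<Rightarrow> nat \<Rightarrow> int" and k :: "nat \<Rightarrow> nat"
    and z :: nat
  assumes z: "z < N"
    and k_pos: "\<And>j. j < K \<Longrightarrow> k j \<ge> 1"
    and coercive: "\<And>\<rho>. \<exists>b. \<forall>u. (\<forall>j<K. sep_poly N (a j) (c j) (k j) u \<ge> - 1) \<and> u z \<le> \<rho>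
                     \<longrightarrow> (\<forall>i<N. \<bar>u i\<bar> \<le> b)"
begin

abbreviation g :: "nat \<Rightarrow> (nat \<Rightarrow> real) \<Rightarrow> real" where
  "g j \<equiv> sep_poly N (a j) (c j) (k j)"

definition relaxed :: "real \<Rightarrow> real \<Rightarrow> (nat \<Rightarrow> real) set" where
  "relaxed \<delta> \<rho> = {u. (\<forall>i\<ge>N. u i = 0) \<and> (\<forall>j<K. g j u \<ge> - \<delta>) \<and> u z \<le> \<rho>}"

lemma compact_relaxed:
  assumes "\<delta> \<le> 1"
  shows "compact (relaxed \<delta> \<rho>)"
proof -
  obtain b where b: "\<And>u i. (\<forall>j<K. g j u \<ge> - 1) \<Longrightarrow> u z \<le> \<rho> \<Longrightarrow> i < N \<Longrightarrow> \<bar>u i\<bar> \<le> b"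
    using coercive[of \<rho>] by blast
  define S where "S i = (if i < N then {- b..b} else {0})" for i :: nat
  have cc: "compact (Pi UNIV S)" by (intro compact_Pi_UNIV) (auto simp: S_def)
  have cl: "closed (relaxed \<delta> \<rho>)"
    unfolding relaxed_def
    by (intro closed_Collect_conj closed_Collect_all closed_Collect_imp open_Collect_const
        closed_Collect_le closed_Collect_eq continuous_intros continuous_on_product_coordinates)
  have "relaxed \<delta> \<rho> \<subseteq> Pi UNIV S"
  proof
    fix u assume u: "u \<in> relaxed \<delta> \<rho>"
    have "\<bar>u i\<bar> \<le> b" if "i < N" for i
    proof (rule b[OF _ _ that])
      show "\<forall>j<K. g j u \<ge> - 1" using u assms unfolding relaxed_def by force
      show "u z \<le> \<rho>" using u by (simp add: relaxed_def)
    qed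
    then show "u \<in> Pi UNIV S" using u by (auto simp: S_def relaxed_def abs_le_iff minus_le_iff)
  qed
  then show ?thesis using compact_Int_closed[OF cc cl] by (simp add: Int_absorb1)
qed

text \<open>\<open>e\<close> is 1 for minimization and -1 for maximization. The weights
  \<open>\<alpha> i\<close> serve the algebra: at a critical point they become the values of the
  gradient polynomials, which would otherwise be 0 and carry no power of \<epsilon>.\<close>

definition barrier :: "real \<Rightarrow> (nat \<Rightarrow> real) \<Rightarrow> (nat \<Rightarrow> real) \<Rightarrow> real \<Rightarrow> (nat \<Rightarrow> real) \<Rightarrow> real" where
  "barrier e \<alpha> \<tau> \<delta> u = e * u z + (\<Sum>i<N. \<alpha> i * u i) - (\<Sum>j<K. \<tau> j * ln (g j u + \<delta>))"

text \<open>The exponential of the negated barrier function extends continuously by 0 to the boundary of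
  the relaxed region, so that a maximizer of it lies in the interior.\<close>

lemma barrier_minimizer:
  assumes \<tau>: "\<And>j. j < K \<Longrightarrow> \<tau> j > 0" and \<delta>: "0 < \<delta>" "\<delta> \<le> 1"
    and w0: "w0 \<in> relaxed 0 \<rho>"
  obtains w where "w \<in> relaxed \<delta> \<rho>" "\<And>j. j < K \<Longrightarrow> g j w + \<delta> > 0"
    "\<And>u. u \<in> relaxed \<delta> \<rho> \<Longrightarrow> (\<forall>j<K. g j u + \<delta> > 0) \<Longrightarrow> barrier e \<alpha> \<tau> \<delta> w \<le> barrier e \<alpha> \<tau> \<delta> u"
proof -
  define \<Psi> where "\<Psi> u = exp (- (e * u z) - (\<Sum>i<N. \<alpha> i * u i)) * (\<Prod>j<K. (g j u + \<delta>) powr \<tau> j)" for u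
  have cont: "continuous_on (relaxed \<delta> \<rho>) \<Psi>"
  proof -
    have coord: "continuous_on (relaxed \<delta> \<rho>) (\<lambda>u. u i)" for i
      by (rule continuous_on_subset[OF continuous_on_product_coordinates]) simp
    \<comment> \<open>Positivity of \<open>\<tau> j\<close> makes the power continuous where its
      base is 0.\<close>
    have "continuous_on (relaxed \<delta> \<rho>) (\<lambda>u. (g j u + \<delta>) powr \<tau> j)" if "j < K" for j
    proof (rule continuous_on_powr')
      show "\<forall>u\<in>relaxed \<delta> \<rho>. 0 \<le> g j u + \<delta> \<and> (g j u + \<delta> = 0 \<longrightarrow> 0 < \<tau> j)"
      proof
        fix u assume "u \<in> relaxed \<delta> \<rho>"
        then have "- \<delta> \<le> g j u" using that by (simp add: relaxed_def)
        then show "0 \<le> g j u + \<delta> \<and> (g j u + \<delta> = 0 \<longrightarrow> 0 < \<tau> j)" using \<tau>[OF that] by simp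
      qed
    qed (intro continuous_intros)+
    then show ?thesis
      unfolding \<Psi>_def[abs_def]
      by (intro continuous_on_mult continuous_on_exp continuous_on_diff continuous_on_minus
          continuous_on_sum continuous_on_prod continuous_on_const coord) simp
  qed
  have g0: "0 \<le> g j w0" if "j < K" for j using w0 that by (simp add: relaxed_def)
  have w0': "w0 \<in> relaxed \<delta> \<rho>"
    using w0 \<delta> unfolding relaxed_def by (auto intro: order_trans[of _ 0])
  have w0p: "\<forall>j<K. g j w0 + \<delta> > 0"
    using g0 \<delta> by (auto intro: add_nonneg_pos)
  have pos: "\<Psi> u = exp (- barrier e \<alpha> \<tau> \<delta> u)" if "\<forall>j<K. g j u + \<delta> > 0" for u
  proof -
    have "(\<Prod>j<K. (g j u + \<delta>) powr \<tau> j) = exp (\<Sum>j<K. \<tau> j * ln (g j u + \<delta>))"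
      unfolding exp_sum[OF finite_lessThan] using that by (intro prod.cong refl) (force simp: powr_def)
    then show ?thesis
      unfolding \<Psi>_def barrier_def by (simp add: exp_add[symmetric])
  qed
  obtain w where w: "w \<in> relaxed \<delta> \<rho>" "\<And>u. u \<in> relaxed \<delta> \<rho> \<Longrightarrow> \<Psi> u \<le> \<Psi> w"
    using continuous_attains_sup[OF compact_relaxed[OF \<delta>(2)] _ cont] w0' by blast
  \<comment> \<open>\<open>w0\<close> satisfies the unrelaxed constraints, so its shifted slacks are
    at least \<delta>; the maximum is therefore positive and no factor vanishes at
    \<open>w\<close>.\<close>
  have "\<Psi> w > 0" using w(2)[OF w0'] pos[OF w0p] by (metis exp_gt_zero less_le_trans)
  have int: "g j w + \<delta> > 0" if "j < K" for j
  proof -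
    have "g j w + \<delta> \<ge> 0" using w(1) that by (auto simp: relaxed_def algebra_simps)
    moreover have "g j w + \<delta> \<noteq> 0"
    proof
      assume "g j w + \<delta> = 0"
      then have "(\<Prod>j<K. (g j w + \<delta>) powr \<tau> j) = 0" using that by (intro prod_zero) auto
      then show False using \<open>\<Psi> w > 0\<close> unfolding \<Psi>_def by (simp only: mult_zero_right less_irrefl)
    qed
    ultimately show ?thesis by simp
  qed
  show thesis
  proof (rule that[OF w(1) int])
    fix u assume u: "u \<in> relaxed \<delta> \<rho>" "\<forall>j<K. g j u + \<delta> > 0"
    then show "barrier e \<alpha> \<tau> \<delta> w \<le> barrier e \<alpha> \<tau> \<delta> u"
      using w(2)[OF u(1)] pos[of u] pos[of w] int by simp
  qed
qed

text \<open>The logarithms keep a minimizer away from every constraint but not from the cap \<rho>,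
  hence the hypothesis \<open>w z < \<rho>\<close>. With all other coordinates frozen, the barrier
  is a function of one variable with a local minimum at \<open>w i\<close>.\<close>

lemma barrier_critical:
  assumes \<tau>: "\<And>j. j < K \<Longrightarrow> \<tau> j > 0"
    and w: "w \<in> relaxed \<delta> \<rho>" "\<And>j. j < K \<Longrightarrow> g j w + \<delta> > 0" "w z < \<rho>"
    and min: "\<And>u. u \<in> relaxed \<delta> \<rho> \<Longrightarrow> (\<forall>j<K. g j u + \<delta> > 0) \<Longrightarrow> barrier e \<alpha> \<tau> \<delta> w \<le> barrier e \<alpha> \<tau> \<delta> u"
    and i: "i < N"
  shows "(\<Sum>j<K. \<tau> j / (g j w + \<delta>) * (of_int (c j i) * (real (k j) * w i ^ (k j - 1))))
     = e * (if i = z then 1 else 0) + \<alpha> i"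
proof -
  define G where "G j s = g j w + of_int (c j i) * (s ^ k j - w i ^ k j)" for j s
  have G: "G j s = g j (w(i := s))" for j s unfolding G_def sep_poly_upd[OF i] ..
  define F where "F s = e * w z + e * (if i = z then s - w i else 0) + ((\<Sum>i<N. \<alpha> i * w i) + \<alpha> i * (s - w i))
    - (\<Sum>j<K. \<tau> j * ln (G j s + \<delta>))" for s
  have F: "F s = barrier e \<alpha> \<tau> \<delta> (w(i := s))" for s
  proof -
    have "(\<Sum>i'<N. \<alpha> i' * (w(i := s)) i') = (\<Sum>i'<N. \<alpha> i' * w i' + (if i' = i then \<alpha> i * (s - w i) else 0))"
      by (intro sum.cong refl) (auto simp: algebra_simps)
    also have "\<dots> = (\<Sum>i<N. \<alpha> i * w i) + \<alpha> i * (s - w i)" using i by (simp add: sum.distrib)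
    finally show ?thesis by (auto simp: F_def barrier_def G algebra_simps)
  qed
  have Gw: "G j (w i) = g j w" for j by (simp add: G_def)
  have Gd: "(G j has_real_derivative of_int (c j i) * (real (k j) * w i ^ (k j - 1))) (at (w i))" for j
    unfolding G_def[abs_def] by (auto intro!: derivative_eq_intros)
  have lin: "((\<lambda>s. if i = z then s - w i else 0) has_real_derivative (if i = z then 1 else 0)) (at (w i))"
    by (cases "i = z") (auto intro!: derivative_eq_intros)
  have d3: "((\<lambda>s. \<tau> j * ln (G j s + \<delta>)) has_real_derivative
      \<tau> j * (1 / (g j w + \<delta>) * (of_int (c j i) * (real (k j) * w i ^ (k j - 1))))) (at (w i))" if "j < K" for j
  proof -
    have "((\<lambda>s. G j s + \<delta>) has_real_derivative of_int (c j i) * (real (k j) * w i ^ (k j - 1))) (at (w i))"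
      using DERIV_add[OF Gd DERIV_const] by simp
    from DERIV_cmult[OF DERIV_chain2[OF DERIV_ln_divide this], of "\<tau> j"]
    show ?thesis using w(2)[OF that] by (simp add: Gw)
  qed
  have d1: "((\<lambda>s. e * w z + e * (if i = z then s - w i else 0)) has_real_derivative
      e * (if i = z then 1 else 0)) (at (w i))"
    using DERIV_add[OF DERIV_const DERIV_cmult[OF lin]] by simp
  have d2: "((\<lambda>s. (\<Sum>i<N. \<alpha> i * w i) + \<alpha> i * (s - w i)) has_real_derivative \<alpha> i) (at (w i))"
    by (auto intro!: derivative_eq_intros)
  have dF: "(F has_real_derivative e * (if i = z then 1 else 0) + \<alpha> i -
      (\<Sum>j<K. \<tau> j * (1 / (g j w + \<delta>) * (of_int (c j i) * (real (k j) * w i ^ (k j - 1)))))) (at (w i))"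
    unfolding F_def[abs_def]
    by (intro DERIV_diff DERIV_add d1 d2 DERIV_sum d3) simp
  \<comment> \<open>An open set of values of coordinate \<open>i\<close> for which the altered point
    stays admissible; the cap matters only if \<open>i = z\<close>.\<close>
  define S where "S = (\<Inter>j\<in>{..<K}. {s. G j s + \<delta> > 0}) \<inter> {s. i = z \<longrightarrow> s < \<rho>}"
  have "continuous_on UNIV (G j)" for j unfolding G_def[abs_def] by (intro continuous_intros)
  moreover have "open {s. i = z \<longrightarrow> s < \<rho>}"
    by (cases "i = z") (auto intro: open_Collect_less continuous_intros)
  ultimately have "open S"
    unfolding S_def by (intro open_Int open_INT open_Collect_less continuous_intros ballI finite_lessThan) auto
  moreover have "w i \<in> S" using w by (auto simp: S_def Gw)
  ultimately obtain d where d: "d > 0" "ball (w i) d \<subseteq> S" unfolding open_contains_ball by blast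
  have "F (w i) \<le> F s" if "\<bar>w i - s\<bar> < d" for s
  proof -
    have s: "s \<in> S" using d that by (auto simp: dist_real_def)
    have "w(i := s) \<in> relaxed \<delta> \<rho>"
    proof -
      have "g j (w(i := s)) \<ge> - \<delta>" if "j < K" for j
        using s that unfolding S_def G by force
      moreover have "(w(i := s)) z \<le> \<rho>" using s w(3) unfolding S_def by auto
      ultimately show ?thesis using w(1) i unfolding relaxed_def by auto
    qed
    then show ?thesis
      unfolding F using min[of "w(i := s)"] s by (auto simp: S_def G)
  qed
  then have "e * (if i = z then 1 else 0) + \<alpha> i -
      (\<Sum>j<K. \<tau> j * (1 / (g j w + \<delta>) * (of_int (c j i) * (real (k j) * w i ^ (k j - 1))))) = 0"
    using DERIV_local_min[OF dF d(1)] by blast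
  then show ?thesis by simp
qed

end

section \<open>Critical points of the perturbed problems and their limit\<close>

lemma ln_over_nat_tendsto_0: "(\<lambda>n. ln (real (n + 2)) / real (n + 2)) \<longlonglongrightarrow> 0"
proof -
  have "filterlim (\<lambda>n. real (n + 2)) at_top sequentially"
    using filterlim_real_sequentially by (rule filterlim_compose) (rule filterlim_add_const_nat_at_top)
  from filterlim_compose[OF ln_x_over_x_tendsto_0 this] show ?thesis by simp
qed

context sep_system
begin

text \<open>Layout of \<open>v\<close>: \<open>N\<close> coordinates of the point, \<open>K\<close>
  multipliers, then \<delta>. The three cases are the gradient equations with the objective moved to
  the left, the definition of the multipliers cleared of denominators, and \<delta> itself; their
  values at a critical point are \<open>\<alpha> i\<close>, \<open>\<tau> j\<close> and
  \<delta>.\<close>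

definition crit_poly :: "int \<Rightarrow> nat \<Rightarrow> (nat \<Rightarrow> real) \<Rightarrow> real" where
  "crit_poly e i v =
     (if i < N then (\<Sum>j<K. v (N + j) * (of_int (c j i * int (k j)) * v i ^ (k j - 1)))
                    + of_int (if i = z then - e else 0)
      else if i < N + K then v i * (g (i - N) v + v (N + K))
      else v (N + K))"

lemma int_poly_fun_crit_poly:
  assumes e: "\<bar>e\<bar> = 1" and d: "\<And>j. j < K \<Longrightarrow> k j \<le> d" "1 \<le> d"
    and W: "1 \<le> W" "\<And>j. j < K \<Longrightarrow> \<bar>a j\<bar> \<le> int W"
      "\<And>j i. j < K \<Longrightarrow> i < N \<Longrightarrow> \<bar>c j i\<bar> \<le> int W"
    and i: "i < N + K + 1"
  shows "int_poly_fun (N + K + 1) (d + 1) ((N + K + 2) * W * d) (crit_poly e i)"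
proof -
  let ?M = "N + K + 1"
  have Wd: "1 \<le> W * d" using W(1) d(2) by (metis mult_le_mono nat_mult_1)
  consider "i < N" | "N \<le> i" "i < N + K" | "i = N + K" using i by linarith
  then show ?thesis
  proof cases
    case 1
    have "int_poly_fun ?M (d + 1) ((\<Sum>j<K. W * d) + 1)
        (\<lambda>v. (\<Sum>j<K. v (N + j) * (of_int (c j i * int (k j)) * v i ^ (k j - 1)))
                    + of_int (if i = z then - e else 0))"
    proof (intro int_poly_fun_add int_poly_fun_sum finite_lessThan)
      show "int_poly_fun ?M (d + 1) 1 (\<lambda>v. of_int (if i = z then - e else 0))"
        using int_poly_fun_mono[OF int_poly_fun_const[of ?M 0 "if i = z then - e else 0"]] e by simp
      fix j assume "j \<in> {..<K}"
      then have j: "j < K" by simp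
      have "int_poly_fun ?M (1 + (0 + (k j - 1) * 1)) (1 * (nat \<bar>c j i * int (k j)\<bar> * 1 ^ (k j - 1)))
         (\<lambda>v. v (N + j) * (of_int (c j i * int (k j)) * v i ^ (k j - 1)))"
        by (intro int_poly_fun_mult int_poly_fun_const int_poly_fun_power int_poly_fun_coord) (use i j in auto)
      moreover have "nat \<bar>c j i * int (k j)\<bar> \<le> W * d"
        using W(3)[OF j 1] d(1)[OF j] by (simp add: abs_mult nat_mult_distrib mult_mono)
      ultimately show "int_poly_fun ?M (d + 1) (W * d)
         (\<lambda>v. v (N + j) * (of_int (c j i * int (k j)) * v i ^ (k j - 1)))"
        by (elim int_poly_fun_mono) (use d(1)[OF j] in auto)
    qed
    moreover have "(\<Sum>j<K. W * d) + 1 \<le> (N + K + 2) * W * d"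
    proof -
      have "K * X + 1 \<le> (N + K + 2) * X" if "1 \<le> X" for X
        using that by (simp add: algebra_simps)
      from this[OF Wd] show ?thesis by (simp only: mult.assoc sum_constant card_lessThan of_nat_id)
    qed
    ultimately have "int_poly_fun ?M (d + 1) ((N + K + 2) * W * d)
        (\<lambda>v. (\<Sum>j<K. v (N + j) * (of_int (c j i * int (k j)) * v i ^ (k j - 1)))
                    + of_int (if i = z then - e else 0))"
      by (elim int_poly_fun_mono) auto
    then show ?thesis using 1 by (simp add: crit_poly_def[abs_def] cong: if_cong)
  next
    case 2
    let ?j = "i - N"
    have j: "?j < K" using 2 by linarith
    have "int_poly_fun ?M (1 + d) (1 * ((W + N * W) + 1)) (\<lambda>v. v i * (g ?j v + v (N + K)))"
    proof (intro int_poly_fun_mult int_poly_fun_add int_poly_fun_coord)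
      show "int_poly_fun ?M d (W + N * W) (g ?j)"
        by (rule int_poly_fun_sep_poly) (use W(2,3)[OF j] d(1)[OF j] in auto)
      show "int_poly_fun ?M d 1 (\<lambda>v. v (N + K))"
        using int_poly_fun_mono[OF int_poly_fun_coord[of "N + K" ?M], of d 1] d(2) by simp
    qed (use 2 in auto)
    moreover have "1 * ((W + N * W) + 1) \<le> (N + K + 2) * W * d"
    proof -
      have "(W + N * W) + 1 \<le> (N + K + 2) * W" using W(1) by (simp add: algebra_simps)
      also have "\<dots> \<le> (N + K + 2) * W * d" using d(2) by simp
      finally show ?thesis by simp
    qed
    ultimately have "int_poly_fun ?M (d + 1) ((N + K + 2) * W * d) (\<lambda>v. v i * (g ?j v + v (N + K)))"
      by (elim int_poly_fun_mono) auto
    then show ?thesis using 2 by (simp add: crit_poly_def[abs_def])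
  next
    case 3
    have "int_poly_fun ?M (d + 1) ((N + K + 2) * W * d) (\<lambda>v. v (N + K))"
    proof (rule int_poly_fun_mono[OF int_poly_fun_coord])
      show "1 \<le> (N + K + 2) * W * d"
        using mult_le_mono[of 1 "N + K + 2" 1 "W * d"] Wd by (simp add: mult.assoc)
    qed auto
    then show ?thesis using 3 by (simp add: crit_poly_def[abs_def])
  qed
qed

text \<open>Comparing the barrier at its minimizer with its value at \<open>w0\<close> shows that
  the objective exceeds the optimum by at most a vanishing error. A limit point is thus feasible and
  optimal; it may differ from \<open>w0\<close>, but not in coordinate \<open>z\<close>.\<close>

lemma perturbed_optimizers:
  fixes e :: int and q :: "nat \<Rightarrow> nat"
  assumes e: "e = 1 \<or> e = - 1" and q: "\<And>i. q i \<ge> 1"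
    and w0: "w0 \<in> relaxed 0 \<rho>" "w0 z < \<rho>"
    and opt: "\<And>u. u \<in> relaxed 0 \<rho> \<Longrightarrow> of_int e * w0 z \<le> of_int e * u z"
  obtains \<epsilon> :: "nat \<Rightarrow> real" and v :: "nat \<Rightarrow> nat \<Rightarrow> real" where
    "\<And>n. \<epsilon> n > 0" "\<epsilon> \<longlonglongrightarrow> 0"
    "\<And>i n. i < N + K + 1 \<Longrightarrow> crit_poly e i (v n) = \<epsilon> n ^ q i"
    "(\<lambda>n. v n z) \<longlonglongrightarrow> w0 z"
proof -
  define \<epsilon> where "\<epsilon> n = 1 / real (n + 2)" for n
  have \<epsilon>: "0 < \<epsilon> n" "\<epsilon> n < 1" for n by (auto simp: \<epsilon>_def)
  have \<epsilon>q: "0 < \<epsilon> n ^ q i" "\<epsilon> n ^ q i \<le> \<epsilon> n" "\<epsilon> n ^ q i \<le> 1" for n i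
  proof -
    show "0 < \<epsilon> n ^ q i" using \<epsilon>[of n] by simp
    show le: "\<epsilon> n ^ q i \<le> \<epsilon> n" using power_decreasing[OF q[of i], of "\<epsilon> n"] \<epsilon>[of n] by simp
    show "\<epsilon> n ^ q i \<le> 1" using le \<epsilon>[of n] by linarith
  qed
  have \<epsilon>0: "\<epsilon> \<longlonglongrightarrow> 0"
    unfolding \<epsilon>_def using LIMSEQ_ignore_initial_segment[OF lim_1_over_n, of 2] by simp
  define \<alpha> where "\<alpha> n i = \<epsilon> n ^ q i" for n i
  define \<tau> where "\<tau> n j = \<epsilon> n ^ q (N + j)" for n j
  define \<delta> where "\<delta> n = \<epsilon> n ^ q (N + K)" for n
  let ?B = "\<lambda>n. barrier (of_int e) (\<alpha> n) (\<tau> n) (\<delta> n)"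
  have "\<exists>w. w \<in> relaxed (\<delta> n) \<rho> \<and> (\<forall>j<K. g j w + \<delta> n > 0) \<and>
      (\<forall>u \<in> relaxed (\<delta> n) \<rho>. (\<forall>j<K. g j u + \<delta> n > 0) \<longrightarrow> ?B n w \<le> ?B n u)" for n
    using barrier_minimizer[of "\<tau> n" "\<delta> n" w0 \<rho> "of_int e" "\<alpha> n"] w0(1) \<epsilon>q
    unfolding \<tau>_def \<delta>_def by metis
  then obtain w where w: "\<And>n. w n \<in> relaxed (\<delta> n) \<rho>" "\<And>n j. j < K \<Longrightarrow> g j (w n) + \<delta> n > 0"
    and wmin: "\<And>n u. u \<in> relaxed (\<delta> n) \<rho> \<Longrightarrow> (\<forall>j<K. g j u + \<delta> n > 0) \<Longrightarrow> ?B n (w n) \<le> ?B n u"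
    by metis
  have mono: "relaxed \<delta>' \<rho> \<subseteq> relaxed 1 \<rho>" if "\<delta>' \<le> 1" for \<delta>'
    using that unfolding relaxed_def by (auto intro: order_trans[of _ "- \<delta>'"])
  have w1: "w n \<in> relaxed 1 \<rho>" for n using w(1)[of n] mono[of "\<delta> n"] \<epsilon>q(3) unfolding \<delta>_def by blast
  have w01: "w0 \<in> relaxed 1 \<rho>" using w0(1) mono[of 0] by auto
  have "compact (relaxed 1 \<rho>)" by (rule compact_relaxed) simp
  then have "seq_compact (relaxed 1 \<rho>)" by (simp add: compact_eq_seq_compact_metric)
  then obtain l r where l: "l \<in> relaxed 1 \<rho>" and r: "strict_mono r" and lim: "(w \<circ> r) \<longlonglongrightarrow> l"
    using w1 unfolding seq_compact_def by metis
  have limi: "(\<lambda>n. w (r n) i) \<longlonglongrightarrow> l i" for i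
    using tendsto_coordinate[OF lim, of i] by simp
  have \<delta>0: "(\<lambda>n. \<delta> (r n)) \<longlonglongrightarrow> 0"
  proof (rule tendsto_sandwich[of "\<lambda>_. 0" _ _ "\<lambda>n. \<epsilon> (r n)"])
    show "(\<lambda>n. \<epsilon> (r n)) \<longlonglongrightarrow> 0" using LIMSEQ_subseq_LIMSEQ[OF \<epsilon>0 r] by (simp add: o_def)
  qed (use \<epsilon>q in \<open>auto simp: \<delta>_def intro!: always_eventually less_imp_le\<close>)
  have l0: "l \<in> relaxed 0 \<rho>"
  proof -
    have "0 \<le> g j l" if "j < K" for j
    proof -
      have "(\<lambda>n. g j (w (r n)) + \<delta> (r n)) \<longlonglongrightarrow> g j l + 0"
        by (intro tendsto_add sep_poly_tendsto limi \<delta>0)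
      moreover have "0 \<le> g j (w (r n)) + \<delta> (r n)" for n using w(2)[OF that, of "r n"] by simp
      ultimately show ?thesis by (intro LIMSEQ_le_const[of _ "g j l" 0]) auto
    qed
    then show ?thesis using l unfolding relaxed_def by auto
  qed
  obtain b where b: "b \<ge> 1" "\<And>u i. u \<in> relaxed 1 \<rho> \<Longrightarrow> i \<in> {..<N} \<Longrightarrow> \<bar>u i\<bar> \<le> b"
  proof (rule bounded_above_on_compact[OF \<open>compact (relaxed 1 \<rho>)\<close>, of "{..<N}" "\<lambda>i u. \<bar>u i\<bar>"])
    show "continuous_on (relaxed 1 \<rho>) (\<lambda>u. \<bar>u i\<bar>)" for i
      by (intro continuous_intros continuous_on_subset[OF continuous_on_product_coordinates]) simp
  qed (use that in auto)
  obtain G where G: "G \<ge> 1" "\<And>u j. u \<in> relaxed 1 \<rho> \<Longrightarrow> j \<in> {..<K} \<Longrightarrow> g j u + 1 \<le> G"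
  proof (rule bounded_above_on_compact[OF \<open>compact (relaxed 1 \<rho>)\<close>, of "{..<K}" "\<lambda>j u. g j u + 1"])
    show "continuous_on (relaxed 1 \<rho>) (\<lambda>u. g j u + 1)" for j by (intro continuous_intros)
  qed (use that in auto)
  \<comment> \<open>The terms come from the linear perturbations at \<open>w n\<close> and at
    \<open>w0\<close> (hence the factor 2), from the logarithms at \<open>w n\<close>, which are at
    most \<open>ln G\<close>, and from those at \<open>w0\<close>. There slacks may vanish and only
    \<open>ln (\<delta> n)\<close>, a multiple of \<open>- ln (n + 2)\<close>, is a lower bound; the
    weight \<open>\<epsilon> n = 1 / (n + 2)\<close> beats it.\<close>
  define err where "err n = 2 * (real N * (\<epsilon> n * b)) + real K * (\<epsilon> n * ln G)
      + real K * (real (q (N + K)) * (ln (real (n + 2)) / real (n + 2)))" for n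
  have est: "of_int e * w n z \<le> of_int e * w0 z + err n" for n
  proof -
    have g0: "0 \<le> g j w0" if "j < K" for j using w0(1) that by (simp add: relaxed_def)
    have le: "?B n (w n) \<le> ?B n w0"
    proof (rule wmin)
      show "w0 \<in> relaxed (\<delta> n) \<rho>"
        using w0(1) \<epsilon>q(1)[of n "N + K"] unfolding relaxed_def \<delta>_def by (auto intro: order_trans[of _ 0])
      show "\<forall>j<K. g j w0 + \<delta> n > 0" using g0 \<epsilon>q(1) by (auto simp: \<delta>_def intro: add_nonneg_pos)
    qed
    have lin: "\<bar>\<Sum>i<N. \<alpha> n i * u i\<bar> \<le> real N * (\<epsilon> n * b)" if "u \<in> relaxed 1 \<rho>" for u
    proof -
      have "\<bar>\<Sum>i<N. \<alpha> n i * u i\<bar> \<le> (\<Sum>i<N. \<epsilon> n * b)"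
        unfolding \<alpha>_def
        by (intro order_trans[OF sum_abs] sum_mono, unfold abs_mult, intro mult_mono)
          (use \<epsilon>q \<epsilon> b(2)[OF that] in \<open>auto simp: abs_of_pos intro: less_imp_le\<close>)
      then show ?thesis by simp
    qed
    have up: "(\<Sum>j<K. \<tau> n j * ln (g j (w n) + \<delta> n)) \<le> real K * (\<epsilon> n * ln G)"
    proof -
      have "\<tau> n j * ln (g j (w n) + \<delta> n) \<le> \<epsilon> n * ln G" if j: "j < K" for j
      proof -
        have "g j (w n) + \<delta> n \<le> G" using G(2)[OF w1[of n], of j] j \<epsilon>q(3)[of n "N + K"] by (simp add: \<delta>_def)
        then have "ln (g j (w n) + \<delta> n) \<le> ln G" using w(2)[OF j, of n] by simp
        then have "\<tau> n j * ln (g j (w n) + \<delta> n) \<le> \<tau> n j * ln G"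
          using \<epsilon>q(1)[of n "N + j"] by (simp add: \<tau>_def)
        also have "\<dots> \<le> \<epsilon> n * ln G" using \<epsilon>q(2)[of n "N + j"] G(1) by (intro mult_right_mono) (auto simp: \<tau>_def)
        finally show ?thesis .
      qed
      then have "(\<Sum>j<K. \<tau> n j * ln (g j (w n) + \<delta> n)) \<le> (\<Sum>j<K. \<epsilon> n * ln G)" by (intro sum_mono) auto
      then show ?thesis by simp
    qed
    have low: "- (\<Sum>j<K. \<tau> n j * ln (g j w0 + \<delta> n))
        \<le> real K * (real (q (N + K)) * (ln (real (n + 2)) / real (n + 2)))"
    proof -
      have "- (\<tau> n j * ln (g j w0 + \<delta> n)) \<le> real (q (N + K)) * (ln (real (n + 2)) / real (n + 2))"
        if j: "j < K" for j
      proof -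
        have "ln (\<delta> n) \<le> ln (g j w0 + \<delta> n)"
          using g0[OF j] \<epsilon>q(1)[of n "N + K"] by (simp add: \<delta>_def add_nonneg_pos)
        moreover have "ln (\<delta> n) = - (real (q (N + K)) * ln (real (n + 2)))"
          using \<epsilon>(1)[of n] by (simp add: \<delta>_def ln_realpow \<epsilon>_def ln_div)
        ultimately have "- ln (g j w0 + \<delta> n) \<le> real (q (N + K)) * ln (real (n + 2))" by linarith
        then have "\<tau> n j * - ln (g j w0 + \<delta> n) \<le> \<tau> n j * (real (q (N + K)) * ln (real (n + 2)))"
          using \<epsilon>q(1)[of n "N + j"] by (intro mult_left_mono) (auto simp: \<tau>_def)
        also have "\<dots> \<le> \<epsilon> n * (real (q (N + K)) * ln (real (n + 2)))"
          using \<epsilon>q(2)[of n "N + j"] by (intro mult_right_mono) (auto simp: \<tau>_def)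
        finally show ?thesis by (simp add: \<epsilon>_def)
      qed
      then have "(\<Sum>j<K. - (\<tau> n j * ln (g j w0 + \<delta> n)))
          \<le> (\<Sum>j<K. real (q (N + K)) * (ln (real (n + 2)) / real (n + 2)))"
        by (intro sum_mono) auto
      then show ?thesis by (simp add: sum_negf)
    qed
    show ?thesis
      using le lin[OF w1[of n]] lin[OF w01] up low unfolding barrier_def err_def by linarith
  qed
  have "err \<longlonglongrightarrow> 2 * (real N * (0 * b)) + real K * (0 * ln G) + real K * (real (q (N + K)) * 0)"
    unfolding err_def by (intro tendsto_intros \<epsilon>0 ln_over_nat_tendsto_0)
  then have "(err \<circ> r) \<longlonglongrightarrow> 0" using LIMSEQ_subseq_LIMSEQ[OF _ r] by simp
  then have "(\<lambda>n. of_int e * w0 z + (err \<circ> r) n) \<longlonglongrightarrow> of_int e * w0 z + 0" by (intro tendsto_intros)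
  moreover have "(\<lambda>n. of_int e * w (r n) z) \<longlonglongrightarrow> of_int e * l z" by (intro tendsto_intros limi)
  ultimately have "of_int e * l z \<le> of_int e * w0 z + 0"
    by (intro LIMSEQ_le[where X = "\<lambda>n. of_int e * w (r n) z"]) (use est in auto)
  then have lz: "l z = w0 z" using opt[OF l0] e by auto
  have "eventually (\<lambda>n. w (r n) z < \<rho>) sequentially"
    using order_tendstoD(2)[OF limi[of z]] lz w0(2) by simp
  then obtain n0 where n0: "\<And>n. n \<ge> n0 \<Longrightarrow> w (r n) z < \<rho>" unfolding eventually_sequentially by blast
  \<comment> \<open>Dropping \<open>n0\<close> terms makes the cap inactive, so that the gradient
    equations hold for all remaining ones.\<close>
  define s where "s n = r (n + n0)" for n
  define v where "v n i = (if i < N then w (s n) i else if i < N + K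
      then \<tau> (s n) (i - N) / (g (i - N) (w (s n)) + \<delta> (s n)) else \<delta> (s n))" for n i
  have gv: "g j (v n) = g j (w (s n))" for j n by (simp add: sep_poly_def v_def)
  show thesis
  proof (rule that[of "\<lambda>n. \<epsilon> (s n)" v])
    show "0 < \<epsilon> (s n)" for n by (rule \<epsilon>)
    show "(\<lambda>n. \<epsilon> (s n)) \<longlonglongrightarrow> 0"
      unfolding s_def using LIMSEQ_ignore_initial_segment[OF LIMSEQ_subseq_LIMSEQ[OF \<epsilon>0 r], of n0]
      by (simp add: o_def)
    show "(\<lambda>n. v n z) \<longlonglongrightarrow> w0 z"
      using LIMSEQ_ignore_initial_segment[OF limi[of z], of n0] z by (simp add: v_def s_def lz)
    show "crit_poly e i (v n) = \<epsilon> (s n) ^ q i" if i: "i < N + K + 1" for i n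
    proof -
      consider "i < N" | "N \<le> i" "i < N + K" | "i = N + K" using i by linarith
      then show ?thesis
      proof cases
        case 1
        have "(\<Sum>j<K. \<tau> (s n) j / (g j (w (s n)) + \<delta> (s n)) *
              (of_int (c j i) * (real (k j) * w (s n) i ^ (k j - 1))))
            = of_int e * (if i = z then 1 else 0) + \<alpha> (s n) i"
        proof (rule barrier_critical[OF _ w(1)[of "s n"] w(2)[of _ "s n"] _ wmin[of _ "s n"] 1])
          show "\<And>j. j < K \<Longrightarrow> 0 < \<tau> (s n) j" using \<epsilon>q(1) by (simp add: \<tau>_def)
          show "w (s n) z < \<rho>" using n0[of "n + n0"] by (simp add: s_def)
        qed auto
        then show ?thesis using 1 by (simp add: crit_poly_def v_def \<alpha>_def mult.assoc)
      next
        case 2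
        then have "g (i - N) (w (s n)) + \<delta> (s n) \<noteq> 0" using w(2)[of "i - N" "s n"] by force
        then show ?thesis using 2 unfolding crit_poly_def gv by (simp add: v_def \<tau>_def)
      next
        case 3
        then show ?thesis by (simp add: crit_poly_def v_def \<delta>_def)
      qed
    qed
  qed
qed

text \<open>The rates are \<open>q i = L ^ i\<close> with the \<open>L\<close> of
  \<open>root_bound\<close> for \<open>N + K + 1\<close> unknowns; \<open>w0 z < \<rho>\<close> says
  that \<open>w0\<close> is not an artefact of the cap.\<close>

lemma optimum_bound:
  fixes e :: int
  assumes e: "e = 1 \<or> e = - 1" and d: "\<And>j. j < K \<Longrightarrow> k j \<le> d" "1 \<le> d"
    and W: "1 \<le> W" "\<And>j. j < K \<Longrightarrow> \<bar>a j\<bar> \<le> int W"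
      "\<And>j i. j < K \<Longrightarrow> i < N \<Longrightarrow> \<bar>c j i\<bar> \<le> int W"
    and w0: "w0 \<in> relaxed 0 \<rho>" "w0 z < \<rho>"
    and opt: "\<And>u. u \<in> relaxed 0 \<rho> \<Longrightarrow> of_int e * w0 z \<le> of_int e * u z"
  shows "\<bar>w0 z\<bar> \<le> real (root_bound (N + K + 1) (d + 1) ((N + K + 2) * W * d))"
proof -
  let ?M = "N + K + 1"
  define L where "L = 2 * (2 * ?M * (d + 1)) ^ ?M"
  have "L > 0" unfolding L_def by (intro mult_pos_pos zero_less_power) auto
  then have L1: "L ^ i \<ge> 1" for i by (simp add: Suc_le_eq)
  obtain \<epsilon> v where v: "\<And>n. \<epsilon> n > 0" "\<epsilon> \<longlonglongrightarrow> 0"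
    "\<And>i n. i < ?M \<Longrightarrow> crit_poly e i (v n) = \<epsilon> n ^ (L ^ i)" "(\<lambda>n. v n z) \<longlonglongrightarrow> w0 z"
    using perturbed_optimizers[OF e, of "\<lambda>i. L ^ i" w0 \<rho>] L1 w0 opt by blast
  have e1: "\<bar>e\<bar> = 1" using e by auto
  have C1: "1 \<le> (N + K + 2) * W * d"
    using W(1) d(2) by (simp add: Suc_le_eq)
  have "\<bar>w0 z\<bar> \<le> 1 + real (2 * (L ^ ?M * (?M * (d + 1) * L)) * ((N + K + 2) * W * d) ^ (?M * L))"
    by (rule elimination_bound[of ?M "d + 1" _ "crit_poly e", OF int_poly_fun_crit_poly[OF e1 d W] _ _ C1 L_def refl v])
      (use z in auto)
  then show ?thesis by (simp add: root_bound_def L_def Let_def)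
qed

lemma coordinate_min_bound:
  assumes d: "\<And>j. j < K \<Longrightarrow> k j \<le> d" "1 \<le> d"
    and W: "1 \<le> W" "\<And>j. j < K \<Longrightarrow> \<bar>a j\<bar> \<le> int W"
      "\<And>j i. j < K \<Longrightarrow> i < N \<Longrightarrow> \<bar>c j i\<bar> \<le> int W"
    and x: "\<forall>i\<ge>N. x i = 0" "\<forall>j<K. g j x \<ge> 0"
  obtains u where "\<forall>i\<ge>N. u i = 0" "\<forall>j<K. g j u \<ge> 0"
    "\<bar>u z\<bar> \<le> real (root_bound (N + K + 1) (d + 1) ((N + K + 2) * W * d))"
proof -
  \<comment> \<open>The cap makes the set compact, and it is inactive at a minimizer, whose
    coordinate \<open>z\<close> is at most \<open>x z\<close>.\<close>
  let ?X = "relaxed 0 (x z + 1)"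
  have x': "x \<in> ?X" using x by (simp add: relaxed_def)
  have "continuous_on ?X (\<lambda>u. u z)"
    by (rule continuous_on_subset[OF continuous_on_product_coordinates]) simp
  then obtain u where u: "u \<in> ?X" "\<And>y. y \<in> ?X \<Longrightarrow> u z \<le> y z"
    using continuous_attains_inf[OF compact_relaxed[of 0 "x z + 1"]] x' by (metis empty_iff zero_le_one)
  have "\<bar>u z\<bar> \<le> real (root_bound (N + K + 1) (d + 1) ((N + K + 2) * W * d))"
    by (rule optimum_bound[of 1, OF _ d W u(1)]) (use u(2) u(2)[OF x'] in auto)
  then show thesis using that u(1) by (auto simp: relaxed_def)
qed

lemma coordinate_max_bound:
  assumes d: "\<And>j. j < K \<Longrightarrow> k j \<le> d" "1 \<le> d"
    and W: "1 \<le> W" "\<And>j. j < K \<Longrightarrow> \<bar>a j\<bar> \<le> int W"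
      "\<And>j i. j < K \<Longrightarrow> i < N \<Longrightarrow> \<bar>c j i\<bar> \<le> int W"
    and bounded: "\<And>y. \<forall>i\<ge>N. y i = 0 \<Longrightarrow> \<forall>j<K. g j y \<ge> 0 \<Longrightarrow> y z \<le> \<beta>"
    and x: "\<forall>i\<ge>N. x i = 0" "\<forall>j<K. g j x \<ge> 0"
  shows "x z \<le> real (root_bound (N + K + 1) (d + 1) ((N + K + 2) * W * d))"
proof -
  \<comment> \<open>As \<open>\<beta>\<close> bounds the coordinate on the whole feasible set, this
    cap excludes no feasible point and is inactive everywhere.\<close>
  let ?X = "relaxed 0 (\<beta> + 1)"
  have X: "y z \<le> \<beta>" if "y \<in> ?X" for y using that bounded[of y] by (auto simp: relaxed_def)
  have x': "x \<in> ?X" using x bounded[OF x] by (simp add: relaxed_def)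
  have "continuous_on ?X (\<lambda>u. u z)"
    by (rule continuous_on_subset[OF continuous_on_product_coordinates]) simp
  then obtain u where u: "u \<in> ?X" "\<And>y. y \<in> ?X \<Longrightarrow> y z \<le> u z"
    using continuous_attains_sup[OF compact_relaxed[of 0 "\<beta> + 1"]] x' by (metis empty_iff zero_le_one)
  have "\<bar>u z\<bar> \<le> real (root_bound (N + K + 1) (d + 1) ((N + K + 2) * W * d))"
    by (rule optimum_bound[of "-1", OF _ d W u(1)]) (use u(2) X[OF u(1)] in auto)
  then show ?thesis using u(2)[OF x'] by linarith
qed

end

section \<open>Helly's theorem for halfspaces and the cone\<close>

text \<open>Gaussian elimination: a pivot \<open>p\<close> of the last equation is removed from the
  others, and its coefficient is solved for at the end.\<close>

lemma linear_dependence: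
  fixes A :: "nat \<Rightarrow> 'i \<Rightarrow> real"
  assumes "finite I" "n < card I"
  shows "\<exists>\<mu>. (\<exists>i\<in>I. \<mu> i \<noteq> 0) \<and> (\<forall>e<n. (\<Sum>i\<in>I. \<mu> i * A e i) = 0)"
  using assms
proof (induction n arbitrary: I A)
  case 0
  then have "I \<noteq> {}" by auto
  then show ?case by (intro exI[of _ "\<lambda>_. 1"]) auto
next
  case (Suc n)
  show ?case
  proof (cases "\<forall>i\<in>I. A n i = 0")
    case True
    obtain \<mu> where "\<exists>i\<in>I. \<mu> i \<noteq> 0" "\<forall>e<n. (\<Sum>i\<in>I. \<mu> i * A e i) = 0"
      using Suc.IH[of I A] Suc.prems by auto
    then show ?thesis using True by (intro exI[of _ \<mu>]) (auto simp: less_Suc_eq)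
  next
    case False
    then obtain p where p: "p \<in> I" "A n p \<noteq> 0" by blast
    define A' where "A' e i = A e i - A e p / A n p * A n i" for e i
    have "n < card (I - {p})" using Suc.prems p by simp
    then obtain \<mu> where \<mu>: "\<exists>i\<in>I - {p}. \<mu> i \<noteq> 0" "\<forall>e<n. (\<Sum>i\<in>I - {p}. \<mu> i * A' e i) = 0"
      using Suc.IH[of "I - {p}" A'] Suc.prems by auto
    define s where "s = (\<Sum>i\<in>I - {p}. \<mu> i * A n i)"
    define \<mu>' where "\<mu>' i = (if i = p then - s / A n p else \<mu> i)" for i
    have split: "(\<Sum>i\<in>I. \<mu>' i * A e i) = - s / A n p * A e p + (\<Sum>i\<in>I - {p}. \<mu> i * A e i)" for e
      using p Suc.prems by (subst sum.remove[of I p]) (auto simp: \<mu>'_def)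
    have "(\<Sum>i\<in>I. \<mu>' i * A e i) = 0" if "e < Suc n" for e
    proof (cases "e = n")
      case True
      then show ?thesis using p split[of n] by (simp add: s_def)
    next
      case False
      then have "0 = (\<Sum>i\<in>I - {p}. \<mu> i * A' e i)" using \<mu>(2) that by simp
      also have "\<dots> = (\<Sum>i\<in>I - {p}. \<mu> i * A e i) - A e p / A n p * s"
        unfolding A'_def s_def sum_distrib_left sum_subtractf[symmetric]
        by (intro sum.cong refl) (simp add: algebra_simps)
      finally show ?thesis using split[of e] by (simp add: algebra_simps)
    qed
    moreover have "\<exists>i\<in>I. \<mu>' i \<noteq> 0" using \<mu>(1) by (auto simp: \<mu>'_def)
    ultimately show ?thesis by blast
  qed
qed

lemma halfspace_convex_combination:
  fixes y :: "'j \<Rightarrow> nat \<Rightarrow> real"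
  assumes "finite S" "\<And>j. j \<in> S \<Longrightarrow> \<theta> j \<ge> 0" "sum \<theta> S = 1"
    and "\<And>j. j \<in> S \<Longrightarrow> (\<Sum>i<N. \<alpha> i * y j i) \<le> \<beta>"
  shows "(\<Sum>i<N. \<alpha> i * (\<Sum>j\<in>S. \<theta> j * y j i)) \<le> \<beta>"
proof -
  have "(\<Sum>i<N. \<alpha> i * (\<Sum>j\<in>S. \<theta> j * y j i)) = (\<Sum>i<N. \<Sum>j\<in>S. \<theta> j * (\<alpha> i * y j i))"
    by (simp add: sum_distrib_left mult_ac)
  also have "\<dots> = (\<Sum>j\<in>S. \<Sum>i<N. \<theta> j * (\<alpha> i * y j i))" by (rule sum.swap)
  also have "\<dots> = (\<Sum>j\<in>S. \<theta> j * (\<Sum>i<N. \<alpha> i * y j i))" by (simp add: sum_distrib_left)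
  also have "\<dots> \<le> (\<Sum>j\<in>S. \<theta> j * \<beta>)" using assms by (intro sum_mono mult_left_mono) auto
  also have "\<dots> = \<beta>" using assms(3) by (simp flip: sum_distrib_right)
  finally show ?thesis .
qed

text \<open>Radon's argument: the induction hypothesis gives points \<open>y j\<close> that can
  violate only halfspace \<open>j\<close>. An affine dependence splits them into two groups whose
  convex hulls meet, and the common point violates no halfspace.\<close>

lemma helly_halfspaces:
  fixes X :: "(nat \<Rightarrow> real) set" and \<alpha> :: "'j \<Rightarrow> nat \<Rightarrow> real" and \<beta> :: "'j \<Rightarrow> real"
  assumes conv: "\<And>S \<theta> y. finite S \<Longrightarrow> (\<And>j. j \<in> S \<Longrightarrow> \<theta> j \<ge> 0) \<Longrightarrow> sum \<theta> S = 1 \<Longrightarrow>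
      (\<And>j :: 'j. j \<in> S \<Longrightarrow> y j \<in> X) \<Longrightarrow> (\<lambda>i. \<Sum>j\<in>S. \<theta> j * y j i) \<in> X"
    and fin: "finite J"
    and small: "\<And>J'. J' \<subseteq> J \<Longrightarrow> card J' \<le> N + 1 \<Longrightarrow> \<exists>y\<in>X. \<forall>j\<in>J'. (\<Sum>i<N. \<alpha> j i * y i) \<le> \<beta> j"
  shows "\<exists>y\<in>X. \<forall>j\<in>J. (\<Sum>i<N. \<alpha> j i * y i) \<le> \<beta> j"
  using fin small
proof (induction J rule: finite_psubset_induct)
  case (psubset J)
  show ?case
  proof (cases "card J \<le> N + 1")
    case True
    then show ?thesis using psubset.prems[of J] by simp
  next
    case False
    have "\<exists>y\<in>X. \<forall>i\<in>J - {j}. (\<Sum>e<N. \<alpha> i e * y e) \<le> \<beta> i" if "j \<in> J" for j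
    proof (rule psubset.IH)
      show "J - {j} \<subset> J" using that by auto
      show "\<exists>y\<in>X. \<forall>i\<in>J'. (\<Sum>e<N. \<alpha> i e * y e) \<le> \<beta> i"
        if "J' \<subseteq> J - {j}" "card J' \<le> N + 1" for J'
        using psubset.prems[of J'] that by auto
    qed
    then have "\<exists>y. \<forall>j\<in>J. y j \<in> X \<and> (\<forall>i\<in>J - {j}. (\<Sum>e<N. \<alpha> i e * y j e) \<le> \<beta> i)"
      by (intro bchoice) blast
    then obtain y where yX: "\<And>j. j \<in> J \<Longrightarrow> y j \<in> X"
      and yH: "\<And>i j. j \<in> J \<Longrightarrow> i \<in> J \<Longrightarrow> i \<noteq> j \<Longrightarrow> (\<Sum>e<N. \<alpha> i e * y j e) \<le> \<beta> i"
      by blast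
    \<comment> \<open>The additional row of ones at \<open>e = N\<close> makes the dependence
      affine: the coefficients sum to 0.\<close>
    obtain \<mu> where \<mu>: "\<exists>j\<in>J. \<mu> j \<noteq> 0"
      "\<And>e. e < N + 1 \<Longrightarrow> (\<Sum>j\<in>J. \<mu> j * (if e < N then y j e else 1)) = 0"
      using linear_dependence[OF psubset.hyps(1), of "N + 1" "\<lambda>e j. if e < N then y j e else 1"] False
      by auto
    have sum0: "(\<Sum>j\<in>J. \<mu> j) = 0" using \<mu>(2)[of N] by simp
    define P where "P = {j\<in>J. \<mu> j > 0}"
    define Q where "Q = J - P"
    have PQ: "finite P" "finite Q" "P \<subseteq> J" "Q \<subseteq> J" using psubset.hyps(1) by (auto simp: P_def Q_def)
    have split: "(\<Sum>j\<in>J. h j) = (\<Sum>j\<in>P. h j) + (\<Sum>j\<in>Q. h j)" for h :: "'j \<Rightarrow> real"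
      using sum.subset_diff[OF PQ(3) psubset.hyps(1), of h] by (simp add: Q_def)
    define s where "s = (\<Sum>j\<in>P. \<mu> j)"
    have sQ: "(\<Sum>j\<in>Q. \<mu> j) = - s" using split[of \<mu>] sum0 by (simp add: s_def)
    have "s > 0"
    proof (rule ccontr)
      assume "\<not> s > 0"
      moreover have "s > 0" if "P \<noteq> {}"
        unfolding s_def by (rule sum_pos[OF PQ(1) that]) (simp add: P_def)
      ultimately have "P = {}" by blast
      then have le0: "0 \<le> - \<mu> j" if "j \<in> J" for j
        using that unfolding P_def by (metis (mono_tags, lifting) empty_iff mem_Collect_eq neg_0_le_iff_le not_less)
      have "(\<Sum>j\<in>J. - \<mu> j) = 0" using sum0 by (simp add: sum_negf)
      then have "\<forall>j\<in>J. - \<mu> j = 0" by (simp only: sum_nonneg_eq_0_iff[OF psubset.hyps(1) le0])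
      then show False using \<mu>(1) by simp
    qed
    define x where "x e = (\<Sum>j\<in>P. \<mu> j / s * y j e)" for e
    have wP: "\<mu> j / s \<ge> 0" if "j \<in> P" for j using that \<open>s > 0\<close> by (simp add: P_def)
    have wQ: "- \<mu> j / s \<ge> 0" if "j \<in> Q" for j using that \<open>s > 0\<close> by (auto simp: P_def Q_def divide_nonpos_pos)
    have oneP: "(\<Sum>j\<in>P. \<mu> j / s) = 1" using \<open>s > 0\<close> by (simp add: s_def flip: sum_divide_distrib)
    have oneQ: "(\<Sum>j\<in>Q. - \<mu> j / s) = 1"
      using \<open>s > 0\<close> sQ by (simp add: sum_negf flip: sum_divide_distrib)
    \<comment> \<open>The two representations of \<open>x\<close> agree only below \<open>N\<close>,
      which suffices for the halfspaces; membership in \<open>X\<close> comes from the first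
      one.\<close>
    have xQ: "x e = (\<Sum>j\<in>Q. - \<mu> j / s * y j e)" if "e < N" for e
    proof -
      have "0 = (\<Sum>j\<in>P. \<mu> j * y j e) + (\<Sum>j\<in>Q. \<mu> j * y j e)"
        using \<mu>(2)[of e] that split[of "\<lambda>j. \<mu> j * y j e"] by simp
      then have "(\<Sum>j\<in>P. \<mu> j * y j e) = (\<Sum>j\<in>Q. - (\<mu> j * y j e))"
        by (simp add: sum_negf)
      then have "(\<Sum>j\<in>P. \<mu> j * y j e) / s = (\<Sum>j\<in>Q. - (\<mu> j * y j e)) / s" by (simp only:)
      then show ?thesis unfolding x_def by (simp add: sum_divide_distrib)
    qed
    have "x \<in> X" unfolding x_def using yX PQ wP oneP by (intro conv) auto
    moreover have "(\<Sum>e<N. \<alpha> i e * x e) \<le> \<beta> i" if i: "i \<in> J" for i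
    proof (cases "i \<in> P")
      case False
      show ?thesis unfolding x_def
        by (rule halfspace_convex_combination[OF PQ(1) wP oneP]) (use yH i False PQ in auto)
    next
      case True
      have "(\<Sum>e<N. \<alpha> i e * (\<Sum>j\<in>Q. - \<mu> j / s * y j e)) \<le> \<beta> i"
        by (rule halfspace_convex_combination[OF PQ(2) wQ oneQ]) (use yH i True PQ in \<open>auto simp: Q_def\<close>)
      then show ?thesis by (simp add: xQ)
    qed
    ultimately show ?thesis by blast
  qed
qed

text \<open>Away from 0 this is \<open>powr_convex\<close>; if one point is 0, it reduces to
  \<open>c powr p \<le> c\<close> for \<open>0 < c < 1\<close>.\<close>

lemma powr_convex_nonneg:
  fixes p :: real
  assumes "p \<ge> 1"
  shows "convex_on {0..} (\<lambda>x. x powr p)"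
proof (rule convex_onI)
  fix t x y :: real
  assume t: "0 < t" "t < 1" and xy: "x \<in> {0..}" "y \<in> {0..}"
  have shrink: "(c * w) powr p \<le> c * w powr p" if "0 < c" "c < 1" "0 \<le> w" for c w :: real
  proof -
    have "c powr p \<le> c powr 1" using that assms by (intro powr_mono') auto
    then show ?thesis using that by (simp add: powr_mult mult_right_mono)
  qed
  show "((1 - t) *\<^sub>R x + t *\<^sub>R y) powr p \<le> (1 - t) * x powr p + t * y powr p"
  proof (cases "x = 0 \<or> y = 0")
    case True
    then show ?thesis using shrink[of "1 - t" x] shrink[of t y] t xy by auto
  next
    case False
    then show ?thesis using convex_onD[OF powr_convex[OF assms], of t x y] t xy by auto
  qed
qed simp

text \<open>Coordinate \<open>n\<close> holds the cone variable. Raising the norm inequality to the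
  power \<open>p\<close> removes the root, but the result no longer implies
  \<open>0 \<le> y n\<close>.\<close>

definition fun_cone :: "real \<Rightarrow> nat \<Rightarrow> (nat \<Rightarrow> real) set" where
  "fun_cone p n = {y. 0 \<le> y n \<and> (\<Sum>i<n. \<bar>y i\<bar> powr p) \<le> y n powr p}"

lemma fun_cone_abs_le:
  assumes "y \<in> fun_cone p n" "i < n" "p > 0"
  shows "\<bar>y i\<bar> \<le> y n"
proof -
  have "\<bar>y i\<bar> powr p \<le> (\<Sum>i<n. \<bar>y i\<bar> powr p)" using assms(2) by (intro member_le_sum) auto
  also have "\<dots> \<le> y n powr p" using assms(1) by (simp add: fun_cone_def)
  finally have "\<bar>y i\<bar> powr p \<le> y n powr p" .
  then show ?thesis
    using assms(1,3) powr_less_mono2[of p "y n" "\<bar>y i\<bar>"] by (force simp: fun_cone_def)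
qed

text \<open>In essence Minkowski's inequality: after scaling all points to last coordinate 1, the
  weights \<open>\<theta> j * y j n / x n\<close> sum to 1 and convexity of the power
  applies.\<close>

lemma fun_cone_combination:
  fixes y :: "'j \<Rightarrow> nat \<Rightarrow> real"
  assumes p: "p \<ge> 1" and fin: "finite S" and \<theta>: "\<And>j. j \<in> S \<Longrightarrow> \<theta> j \<ge> 0"
    and y: "\<And>j. j \<in> S \<Longrightarrow> y j \<in> fun_cone p n"
  shows "(\<lambda>i. \<Sum>j\<in>S. \<theta> j * y j i) \<in> fun_cone p n"
proof -
  define x where "x i = (\<Sum>j\<in>S. \<theta> j * y j i)" for i
  have y0: "0 \<le> y j n" if "j \<in> S" for j using y[OF that] by (simp add: fun_cone_def)
  have x0: "0 \<le> x n" unfolding x_def using \<theta> y0 by (intro sum_nonneg) auto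
  have le: "\<bar>y j i\<bar> \<le> y j n" if "j \<in> S" "i < n" for i j using fun_cone_abs_le[OF y] that p by auto
  have "(\<Sum>i<n. \<bar>x i\<bar> powr p) \<le> x n powr p"
  proof (cases "x n = 0")
    case True
    then have "\<forall>j\<in>S. \<theta> j * y j n = 0"
      using sum_nonneg_eq_0_iff[OF fin, of "\<lambda>j. \<theta> j * y j n"] \<theta> y0 by (auto simp: x_def)
    then have "\<forall>j\<in>S. \<forall>i<n. \<theta> j * y j i = 0" using le by fastforce
    then have "\<forall>i<n. x i = 0" unfolding x_def by (intro allI impI sum.neutral) auto
    then show ?thesis by simp
  next
    case False
    then have xn: "x n > 0" using x0 by simp
    define w where "w j = \<theta> j * y j n / x n" for j
    \<comment> \<open>If \<open>y j n = 0\<close>, the quotient is 0 by convention; this is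
      consistent because then \<open>y j i = 0\<close> for all \<open>i < n\<close>.\<close>
    define t where "t i j = \<bar>y j i\<bar> / y j n" for i j
    have w: "w j \<ge> 0" if "j \<in> S" for j using \<theta>[OF that] y0[OF that] xn by (simp add: w_def)
    have w1: "sum w S = 1" using xn by (simp add: w_def x_def flip: sum_divide_distrib)
    have "S \<noteq> {}" using w1 by auto
    have step: "(\<bar>x i\<bar> / x n) powr p \<le> (\<Sum>j\<in>S. w j * t i j powr p)" if i: "i < n" for i
    proof -
      have "\<bar>x i\<bar> \<le> (\<Sum>j\<in>S. \<bar>\<theta> j * y j i\<bar>)" unfolding x_def by (rule sum_abs)
      also have "\<dots> = (\<Sum>j\<in>S. x n * (w j * t i j))"
      proof (intro sum.cong refl)
        fix j assume j: "j \<in> S"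
        show "\<bar>\<theta> j * y j i\<bar> = x n * (w j * t i j)"
          using le[OF j i] \<theta>[OF j] xn by (cases "y j n = 0") (auto simp: w_def t_def abs_mult)
      qed
      finally have "\<bar>x i\<bar> / x n \<le> (\<Sum>j\<in>S. w j * t i j)"
        using xn by (simp add: divide_le_eq mult.commute flip: sum_distrib_left)
      then have "(\<bar>x i\<bar> / x n) powr p \<le> (\<Sum>j\<in>S. w j * t i j) powr p"
        using xn p by (intro powr_mono2) auto
      also have "\<dots> \<le> (\<Sum>j\<in>S. w j * t i j powr p)"
        using convex_on_sum[OF fin \<open>S \<noteq> {}\<close> powr_convex_nonneg[OF p] w1 w, of "t i"] y0
        by (simp add: t_def)
      finally show ?thesis .
    qed
    have "(\<Sum>i<n. \<bar>x i\<bar> powr p) = x n powr p * (\<Sum>i<n. (\<bar>x i\<bar> / x n) powr p)"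
      using xn by (simp add: powr_divide sum_distrib_left)
    also have "\<dots> \<le> x n powr p * (\<Sum>i<n. \<Sum>j\<in>S. w j * t i j powr p)"
      by (intro mult_left_mono sum_mono step) auto
    also have "(\<Sum>i<n. \<Sum>j\<in>S. w j * t i j powr p) = (\<Sum>j\<in>S. w j * (\<Sum>i<n. t i j powr p))"
      by (subst sum.swap) (simp add: sum_distrib_left)
    also have "\<dots> \<le> (\<Sum>j\<in>S. w j * 1)"
    proof (intro sum_mono mult_left_mono w)
      fix j assume j: "j \<in> S"
      show "(\<Sum>i<n. t i j powr p) \<le> 1"
      proof (cases "y j n = 0")
        case False
        then have pos: "y j n > 0" using y0[OF j] by simp
        have "(\<Sum>i<n. t i j powr p) = (\<Sum>i<n. \<bar>y j i\<bar> powr p) / y j n powr p"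
          using pos by (simp add: t_def powr_divide sum_divide_distrib)
        then show ?thesis using y[OF j] pos by (simp add: fun_cone_def)
      qed (simp add: t_def)
    qed
    finally show ?thesis using w1 by (simp add: mult_left_mono)
  qed
  then show ?thesis using x0 unfolding fun_cone_def x_def by simp
qed

section \<open>The p-order cone in polynomial coordinates\<close>

lemma power_powr_quotient:
  fixes u :: real
  assumes "0 \<le> u" "0 < s" "0 < r"
  shows "(u ^ s) powr (real r / real s) = u ^ r"
proof (cases "u = 0")
  case False
  then have "u > 0" using assms by simp
  then show ?thesis using assms by (simp add: powr_powr flip: powr_realpow)
qed (use assms in \<open>simp add: zero_power\<close>)

definition halfspaces ::
    "nat \<Rightarrow> (nat \<Rightarrow> nat \<Rightarrow> int) \<Rightarrow> (nat \<Rightarrow> int) \<Rightarrow> nat set \<Rightarrow> (nat \<Rightarrow> real) set" where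
  "halfspaces N A H J = {y. \<forall>j\<in>J. (\<Sum>i<N. of_int (A j i) * y i) \<le> of_int (H j)}"

text \<open>On the orthant with sign vector \<open>\<sigma>\<close>, the substitution \<open>x\<^sub>i = \<sigma>\<^sub>i u\<^sub>i\<^sup>s\<close>, \<open>z = u\<^sub>n\<^sup>s\<close> with \<open>u \<ge> 0\<close> makes
  all constraints polynomial: the cone becomes \<open>u\<^sub>n\<^sup>r - \<Sum> u\<^sub>i\<^sup>r \<ge> 0\<close>.  The constraints are numbered with
  the \<open>m\<close> halfspaces first, then the cone, then the sign conditions.\<close>

locale orthant =
  fixes n r s m :: nat and A :: "nat \<Rightarrow> nat \<Rightarrow> int" and H :: "nat \<Rightarrow> int" and \<sigma> :: "nat \<Rightarrow> int"
    and h :: "nat \<Rightarrow> nat"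
  assumes sr: "0 < s" "s < r" and \<sigma>: "\<And>i. \<sigma> i = 1 \<or> \<sigma> i = - 1" "\<sigma> n = 1"
begin

definition con :: "nat \<Rightarrow> int" where
  "con j = (if j < m then H (h j) else 0)"

definition lin :: "nat \<Rightarrow> nat \<Rightarrow> int" where
  "lin j i = (if j < m then - (A (h j) i * \<sigma> i)
             else if j = m then (if i = n then 1 else - 1)
             else if i = j - m - 1 then 1 else 0)"

definition deg :: "nat \<Rightarrow> nat" where
  "deg j = (if j < m then s else if j = m then r else 1)"

text \<open>\<open>m\<close> halfspaces, one cone inequality and \<open>n + 1\<close> sign
  conditions.\<close>

definition K :: nat where "K = m + n + 2"

abbreviation G :: "nat \<Rightarrow> (nat \<Rightarrow> real) \<Rightarrow> real" where
  "G j \<equiv> sep_poly (Suc n) (con j) (lin j) (deg j)"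

definition signed_power :: "(nat \<Rightarrow> real) \<Rightarrow> nat \<Rightarrow> real" where
  "signed_power u i = of_int (\<sigma> i) * u i ^ s"

lemma G_halfspace: "j < m \<Longrightarrow> G j u = of_int (H (h j)) - (\<Sum>i<Suc n. of_int (A (h j) i) * signed_power u i)"
  unfolding sep_poly_def con_def lin_def deg_def signed_power_def by (simp add: sum_negf mult.assoc)

lemma G_cone: "G m u = u n ^ r - (\<Sum>i<n. u i ^ r)"
  by (simp add: sep_poly_def con_def lin_def deg_def sum_negf)

lemma G_sign:
  assumes "i \<le> n"
  shows "G (Suc (m + i)) u = u i"
proof -
  have "(\<Sum>i'<Suc n. of_int (lin (Suc (m + i)) i') * u i' ^ deg (Suc (m + i))) = (\<Sum>i'<Suc n. if i' = i then u i' else 0)"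
    by (intro sum.cong refl) (auto simp: lin_def deg_def)
  then show ?thesis using assms by (simp add: sep_poly_def con_def)
qed

text \<open>\<open>P\<close> is left open to serve both feasibility (at least 0) and coercivity (at
  least -1).\<close>

lemma all_constraints:
  "(\<forall>j<K. P (G j u)) \<longleftrightarrow> (\<forall>j<m. P (G j u)) \<and> P (G m u) \<and> (\<forall>i\<le>n. P (u i))"
proof -
  have "(\<forall>j<K. P (G j u)) \<longleftrightarrow> (\<forall>j<m. P (G j u)) \<and> P (G m u) \<and> (\<forall>i\<le>n. P (G (Suc (m + i)) u))"
  proof (intro iffI conjI allI impI)
    fix j assume *: "(\<forall>j<m. P (G j u)) \<and> P (G m u) \<and> (\<forall>i\<le>n. P (G (Suc (m + i)) u))" and "j < K"
    then consider "j < m" | "j = m" | "j = Suc (m + (j - m - 1))" "j - m - 1 \<le> n"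
      unfolding K_def by linarith
    then show "P (G j u)" using * by cases metis+
  qed (auto simp: K_def)
  then show ?thesis by (simp add: G_sign)
qed

text \<open>The relaxed sign conditions \<open>u i \<ge> - 1\<close> keep each
  \<open>u i ^ r\<close> at least -1, even for odd \<open>r\<close>; the relaxed cone inequality
  then bounds every single power by \<open>b ^ r + 1 + n\<close>.\<close>

lemma coercive:
  "\<exists>b. \<forall>u. (\<forall>j<K. G j u \<ge> - 1) \<and> u n \<le> \<rho> \<longrightarrow> (\<forall>i<Suc n. \<bar>u i\<bar> \<le> b)"
proof -
  define b where "b = max 1 \<bar>\<rho>\<bar>"
  have b: "1 \<le> b" "\<bar>\<rho>\<bar> \<le> b" by (auto simp: b_def)
  have br: "b \<le> b ^ r" using b(1) sr self_le_power[of b r] by simp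
  have "\<bar>u i\<bar> \<le> b ^ r + 1 + real n" if u: "\<forall>j<K. G j u \<ge> - 1" "u n \<le> \<rho>" and i: "i < Suc n" for u i
  proof -
    have cone: "(\<Sum>i<n. u i ^ r) \<le> u n ^ r + 1" and ge: "u i \<ge> - 1" if "i \<le> n" for i
      using u(1)[unfolded all_constraints[of "\<lambda>x. x \<ge> - 1"]] that unfolding G_cone by auto
    have un: "\<bar>u n\<bar> \<le> b" using ge[of n] u(2) b by linarith
    show ?thesis
    proof (cases "i = n")
      case True
      then show ?thesis using un br by simp
    next
      case False
      then have i: "i < n" using i by simp
      have low: "- 1 \<le> u i' ^ r" if "i' < n" for i'
      proof (cases "u i' \<ge> 0")
        case True
        then have "0 \<le> u i' ^ r" by simp
        then show ?thesis by linarith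
      next
        case False
        then have "\<bar>u i'\<bar> \<le> 1" using ge[of i'] that by auto
        then have "\<bar>u i'\<bar> ^ r \<le> 1" by (intro power_le_one) auto
        then show ?thesis by (simp add: abs_le_iff flip: power_abs)
      qed
      have "u i ^ r + (\<Sum>i'\<in>{..<n} - {i}. - 1) \<le> u i ^ r + (\<Sum>i'\<in>{..<n} - {i}. u i' ^ r)"
        by (intro add_left_mono sum_mono low) auto
      also have "\<dots> = (\<Sum>i<n. u i ^ r)" using i by (subst sum.remove[of "{..<n}" i]) auto
      also have "\<dots> \<le> \<bar>u n\<bar> ^ r + 1" using cone[of n] abs_ge_self[of "u n ^ r"] by (simp add: power_abs)
      also have "\<dots> \<le> b ^ r + 1" using un by (intro add_right_mono power_mono) auto
      finally have "u i ^ r \<le> b ^ r + 1 + real n" using i by simp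
      moreover have "u i \<le> u i ^ r" if "1 \<le> u i" using that sr self_le_power[of "u i" r] by simp
      ultimately show ?thesis using ge[of i] i br b(1) by (cases "1 \<le> u i") auto
    qed
  qed
  then show ?thesis by blast
qed

sublocale sep_system "Suc n" K con lin deg n
proof
  show "1 \<le> deg j" for j using sr by (simp add: deg_def)
  show "\<exists>b. \<forall>u. (\<forall>j<K. G j u \<ge> - 1) \<and> u n \<le> \<rho> \<longrightarrow> (\<forall>i<Suc n. \<bar>u i\<bar> \<le> b)" for \<rho>
    by (rule coercive)
qed simp

text \<open>For nonnegative \<open>u\<close> the exponents cancel:
  \<open>(u ^ s) powr (r / s) = u ^ r\<close>.\<close>

lemma feasible_iff:
  assumes p: "p = real r / real s"
  shows "(\<forall>j<K. G j u \<ge> 0) \<longleftrightarrow>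
    signed_power u \<in> fun_cone p n \<inter> halfspaces (Suc n) A H (h ` {..<m}) \<and> (\<forall>i\<le>n. u i \<ge> 0)"
proof (cases "\<forall>i\<le>n. u i \<ge> 0")
  case True
  have abs: "\<bar>signed_power u i\<bar> powr p = u i ^ r" if "i \<le> n" for i
  proof -
    have "\<bar>signed_power u i\<bar> = u i ^ s" using \<sigma>(1)[of i] True that by (auto simp: signed_power_def abs_mult)
    then show ?thesis using power_powr_quotient[of "u i" s r] True that sr p by simp
  qed
  have sn: "0 \<le> signed_power u n" using True \<sigma>(2) by (simp add: signed_power_def)
  have "(G m u \<ge> 0) \<longleftrightarrow> signed_power u \<in> fun_cone p n"
    using abs[of n] sn by (simp add: G_cone fun_cone_def abs)
  moreover have "(\<forall>j<m. G j u \<ge> 0) \<longleftrightarrow> signed_power u \<in> halfspaces (Suc n) A H (h ` {..<m})"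
    by (auto simp: G_halfspace halfspaces_def)
  ultimately show ?thesis using True by (auto simp: all_constraints[of "\<lambda>x. x \<ge> 0"])
next
  case False
  then show ?thesis by (auto simp: all_constraints[of "\<lambda>x. x \<ge> 0"])
qed

lemma coefficient_bounds:
  assumes W: "1 \<le> W" and bd: "\<And>j. j < m \<Longrightarrow> \<bar>H (h j)\<bar> \<le> int W"
      "\<And>j i. j < m \<Longrightarrow> i < Suc n \<Longrightarrow> \<bar>A (h j) i\<bar> \<le> int W"
  shows "\<bar>con j\<bar> \<le> int W" "i < Suc n \<Longrightarrow> \<bar>lin j i\<bar> \<le> int W" "deg j \<le> r"
proof -
  show "\<bar>con j\<bar> \<le> int W" using bd by (simp add: con_def)
  show "\<bar>lin j i\<bar> \<le> int W" if "i < Suc n"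
    using bd(2)[of j i] that \<sigma>(1)[of i] W by (auto simp: lin_def abs_mult)
  show "deg j \<le> r" using sr by (simp add: deg_def)
qed

end

section \<open>Bounds for the cone coordinate\<close>

lemma sign_substitution:
  fixes y :: "nat \<Rightarrow> real"
  assumes s: "0 < s" and yn: "0 \<le> y n"
  obtains \<sigma> :: "nat \<Rightarrow> int" and u :: "nat \<Rightarrow> real" where
    "\<And>i. \<sigma> i = 1 \<or> \<sigma> i = - 1" "\<sigma> n = 1" "\<And>i. 0 \<le> u i" "\<And>i. i > n \<Longrightarrow> u i = 0"
    "\<And>i. i \<le> n \<Longrightarrow> of_int (\<sigma> i) * u i ^ s = y i"
proof (rule that[of "\<lambda>i. if 0 \<le> y i then 1 else - 1" "\<lambda>i. if i \<le> n then root s \<bar>y i\<bar> else 0"])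
qed (use s yn in \<open>auto simp: real_root_ge_zero\<close>)

text \<open>\<open>n + 1\<close> coordinates, at most \<open>(n + 2) + n + 2\<close> constraints and
  \<delta> give \<open>3 * n + 6\<close> unknowns. The outer power is there because
  \<open>root_bound\<close> controls \<open>u_n\<close>, while \<open>z = u_n^s\<close> with
  \<open>s < r\<close>.\<close>

definition z_bound :: "nat \<Rightarrow> nat \<Rightarrow> nat \<Rightarrow> nat" where
  "z_bound n r \<tau> = root_bound (3 * n + 6) (r + 1) ((3 * n + 7) * 2 ^ \<tau> * r) ^ r"

text \<open>Only the orthant containing \<open>y\<close> is considered. For the first claim any
  point of it will do; for the second, \<open>y\<close> itself lies there and is dominated by the
  maximum over it.\<close>

lemma few_halfspaces_bound:
  fixes n r s \<tau> :: nat and A :: "nat \<Rightarrow> nat \<Rightarrow> int" and H :: "nat \<Rightarrow> int"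
  assumes sr: "0 < s" "s < r" and p: "p = real r / real s"
    and J: "finite J" "card J \<le> n + 2"
    and bd: "\<And>j. j \<in> J \<Longrightarrow> \<bar>H j\<bar> \<le> 2 ^ \<tau>" "\<And>j i. j \<in> J \<Longrightarrow> i < Suc n \<Longrightarrow> \<bar>A j i\<bar> \<le> 2 ^ \<tau>"
    and y: "y \<in> fun_cone p n \<inter> halfspaces (Suc n) A H J"
  shows "\<exists>y' \<in> fun_cone p n \<inter> halfspaces (Suc n) A H J. y' n \<le> real (z_bound n r \<tau>)"
    and "(\<And>y'. y' \<in> fun_cone p n \<inter> halfspaces (Suc n) A H J \<Longrightarrow> y' n \<le> \<beta>) \<Longrightarrow> y n \<le> real (z_bound n r \<tau>)"
proof -
  have "0 \<le> y n" using y by (simp add: fun_cone_def)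
  from sign_substitution[OF sr(1), of y n, OF this] obtain \<sigma> u where
    \<sigma>: "\<And>i. \<sigma> i = 1 \<or> \<sigma> i = - 1" "\<sigma> n = 1" and u: "\<And>i. 0 \<le> u i" "\<And>i. i > n \<Longrightarrow> u i = 0"
    and \<sigma>u: "\<And>i. i \<le> n \<Longrightarrow> of_int (\<sigma> i) * u i ^ s = y i" by metis
  obtain h where "bij_betw h {0..<card J} J" using ex_bij_betw_nat_finite[OF J(1)] by blast
  then have h: "h ` {..<card J} = J" by (simp add: bij_betw_def lessThan_atLeast0)
  interpret orthant n r s "card J" A H \<sigma> h
    by unfold_locales (use sr \<sigma> in auto)
  have hJ: "h j \<in> J" if "j < card J" for j using h that by auto
  let ?S = "fun_cone p n \<inter> halfspaces (Suc n) A H J"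
  let ?B = "root_bound (Suc n + K + 1) (r + 1) ((Suc n + K + 2) * 2 ^ \<tau> * r)"
  have W: "1 \<le> (2 :: nat) ^ \<tau>" by simp
  have hA: "\<bar>H (h j)\<bar> \<le> int (2 ^ \<tau>)" "i < Suc n \<Longrightarrow> \<bar>A (h j) i\<bar> \<le> int (2 ^ \<tau>)"
    if "j < card J" for i j using bd hJ[OF that] by simp_all
  have cb: "\<bar>con j\<bar> \<le> int (2 ^ \<tau>)" "i < Suc n \<Longrightarrow> \<bar>lin j i\<bar> \<le> int (2 ^ \<tau>)" "deg j \<le> r" for i j
    using coefficient_bounds[OF W hA] by blast+
  have B: "real ?B ^ s \<le> real (z_bound n r \<tau>)"
  proof -
    have "?B \<le> root_bound (3 * n + 6) (r + 1) ((3 * n + 7) * 2 ^ \<tau> * r)"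
      using J(2) sr by (intro root_bound_mono mult_le_mono) (auto simp: K_def Suc_le_eq)
    then have "?B ^ s \<le> root_bound (3 * n + 6) (r + 1) ((3 * n + 7) * 2 ^ \<tau> * r) ^ s"
      by (intro power_mono) auto
    also have "\<dots> \<le> z_bound n r \<tau>"
      unfolding z_bound_def using sr by (intro power_increasing) (auto simp: root_bound_def Let_def)
    finally show ?thesis by (simp flip: of_nat_power)
  qed
  have cone_eq: "v \<in> ?S \<longleftrightarrow> w \<in> ?S" if "\<And>i. i \<le> n \<Longrightarrow> v i = w i" for v w
    using that by (simp add: fun_cone_def halfspaces_def)
  have uS: "\<forall>j<K. G j u \<ge> 0"
    using y cone_eq[of "signed_power u" y] \<sigma>u u unfolding feasible_iff[OF p] h by (simp add: signed_power_def)
  have u0: "\<forall>i\<ge>Suc n. u i = 0" using u(2) by simp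
  have pow_le: "v ^ s \<le> real (z_bound n r \<tau>)" if "v \<le> real ?B" "0 \<le> v" for v
    using power_mono[OF that, of s] B by linarith
  have r1: "1 \<le> r" using sr by simp
  show "\<exists>y' \<in> ?S. y' n \<le> real (z_bound n r \<tau>)"
  proof -
    obtain v where v: "\<forall>i\<ge>Suc n. v i = 0" "\<forall>j<K. G j v \<ge> 0" "\<bar>v n\<bar> \<le> real ?B"
      using coordinate_min_bound[OF cb(3) r1 W cb(1,2) u0 uS] by blast
    have "signed_power v \<in> ?S" "0 \<le> v n" using v(2) unfolding feasible_iff[OF p] h by auto
    moreover have "signed_power v n \<le> real (z_bound n r \<tau>)"
      using pow_le[of "v n"] v(3) \<open>0 \<le> v n\<close> \<sigma>(2) by (simp add: signed_power_def)
    ultimately show ?thesis by blast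
  qed
  show "y n \<le> real (z_bound n r \<tau>)" if bounded: "\<And>y'. y' \<in> ?S \<Longrightarrow> y' n \<le> \<beta>"
  proof -
    \<comment> \<open>Turns a bound on \<open>v n ^ s\<close> into one on \<open>v n\<close>, as
      \<open>v n \<le> v n ^ s\<close> from 1 onwards.\<close>
    have vb: "v n \<le> max 1 \<beta>" if "\<forall>j<K. G j v \<ge> 0" for v
    proof (cases "1 \<le> v n")
      case True
      have "signed_power v \<in> ?S" using that unfolding feasible_iff[OF p] h by auto
      then have "v n ^ s \<le> \<beta>" using bounded \<sigma>(2) by (force simp: signed_power_def)
      then show ?thesis using self_le_power[OF True sr(1)] by linarith
    qed auto
    have "u n \<le> real ?B"
      by (rule coordinate_max_bound[where \<beta> = "max 1 \<beta>", OF cb(3) r1 W cb(1,2) _ u0 uS]) (assumption, rule vb, assumption)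
    then show ?thesis using pow_le[of "u n"] u(1) \<sigma>u[of n] \<sigma>(2) by simp
  qed
qed

text \<open>In \<open>n + 1\<close> coordinates Helly's theorem asks for families of at most
  \<open>n + 2\<close> halfspaces. A subfamily of a bounded system may be unbounded, so the second
  claim does not pass to subfamilies directly; it is proved by contradiction.\<close>

lemma halfspaces_bound:
  fixes n r s \<tau> :: nat and A :: "nat \<Rightarrow> nat \<Rightarrow> int" and H :: "nat \<Rightarrow> int"
  assumes sr: "0 < s" "s < r" and p: "p = real r / real s"
    and J: "finite J"
    and bd: "\<And>j. j \<in> J \<Longrightarrow> \<bar>H j\<bar> \<le> 2 ^ \<tau>" "\<And>j i. j \<in> J \<Longrightarrow> i < Suc n \<Longrightarrow> \<bar>A j i\<bar> \<le> 2 ^ \<tau>"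
    and y: "y \<in> fun_cone p n \<inter> halfspaces (Suc n) A H J"
  shows "\<exists>y' \<in> fun_cone p n \<inter> halfspaces (Suc n) A H J. y' n \<le> real (z_bound n r \<tau>)"
    and "(\<And>y'. y' \<in> fun_cone p n \<inter> halfspaces (Suc n) A H J \<Longrightarrow> y' n \<le> \<beta>) \<Longrightarrow> y n \<le> real (z_bound n r \<tau>)"
proof -
  let ?R = "real (z_bound n r \<tau>)"
  have p1: "1 \<le> p" using sr by (simp add: p)
  have sub: "halfspaces (Suc n) A H J \<subseteq> halfspaces (Suc n) A H J'" if "J' \<subseteq> J" for J'
    using that by (auto simp: halfspaces_def)
  have comb: "(\<Sum>j\<in>S. \<theta> j * c) = c" if "sum \<theta> S = 1" for S and \<theta> :: "nat \<Rightarrow> real" and c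
    using that by (simp flip: sum_distrib_right)
  show "\<exists>y' \<in> fun_cone p n \<inter> halfspaces (Suc n) A H J. y' n \<le> ?R"
  proof -
    let ?X = "fun_cone p n \<inter> {y. y n \<le> ?R}"
    have "\<exists>y\<in>?X. \<forall>j\<in>J. (\<Sum>i<Suc n. of_int (A j i) * y i) \<le> real_of_int (H j)"
    proof (rule helly_halfspaces[OF _ J])
      fix S :: "nat set" and \<theta> :: "nat \<Rightarrow> real" and w :: "nat \<Rightarrow> nat \<Rightarrow> real"
      assume *: "finite S" "\<And>j. j \<in> S \<Longrightarrow> 0 \<le> \<theta> j" "sum \<theta> S = 1" "\<And>j. j \<in> S \<Longrightarrow> w j \<in> ?X"
      have "(\<Sum>j\<in>S. \<theta> j * w j n) \<le> (\<Sum>j\<in>S. \<theta> j * ?R)"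
        using *(2,4) by (intro sum_mono mult_left_mono) auto
      then show "(\<lambda>i. \<Sum>j\<in>S. \<theta> j * w j i) \<in> ?X"
        using fun_cone_combination[OF p1 *(1,2), where y = w and n = n] *(4) comb[OF *(3)] by auto
    next
      fix J' assume J': "J' \<subseteq> J" "card J' \<le> Suc n + 1"
      have "\<exists>y' \<in> fun_cone p n \<inter> halfspaces (Suc n) A H J'. y' n \<le> ?R"
        using J' finite_subset[OF J'(1) J] y sub[OF J'(1)]
        by (intro few_halfspaces_bound(1)[OF sr p _ _ bd]) auto
      then show "\<exists>y\<in>?X. \<forall>j\<in>J'. (\<Sum>i<Suc n. of_int (A j i) * y i) \<le> real_of_int (H j)"
        by (auto simp: halfspaces_def)
    qed
    then show ?thesis by (auto simp: halfspaces_def)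
  qed
  show "y n \<le> ?R" if bounded: "\<And>y'. y' \<in> fun_cone p n \<inter> halfspaces (Suc n) A H J \<Longrightarrow> y' n \<le> \<beta>"
  proof (rule ccontr)
    assume "\<not> y n \<le> ?R"
    \<comment> \<open>If \<open>y n\<close> exceeds the bound, every small subfamily has points
      above this height, as otherwise the bounded case would apply to \<open>y\<close>. Helly's
      theorem then gives a point of the full system above \<open>\<beta>\<close>.\<close>
    let ?X = "fun_cone p n \<inter> {y. max \<beta> ?R + 1 \<le> y n}"
    have "\<exists>y\<in>?X. \<forall>j\<in>J. (\<Sum>i<Suc n. of_int (A j i) * y i) \<le> real_of_int (H j)"
    proof (rule helly_halfspaces[OF _ J])
      fix S :: "nat set" and \<theta> :: "nat \<Rightarrow> real" and w :: "nat \<Rightarrow> nat \<Rightarrow> real"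
      assume *: "finite S" "\<And>j. j \<in> S \<Longrightarrow> 0 \<le> \<theta> j" "sum \<theta> S = 1" "\<And>j. j \<in> S \<Longrightarrow> w j \<in> ?X"
      have "(\<Sum>j\<in>S. \<theta> j * (max \<beta> ?R + 1)) \<le> (\<Sum>j\<in>S. \<theta> j * w j n)"
        using *(2,4) by (intro sum_mono mult_left_mono) auto
      then show "(\<lambda>i. \<Sum>j\<in>S. \<theta> j * w j i) \<in> ?X"
        using fun_cone_combination[OF p1 *(1,2), where y = w and n = n] *(4) comb[OF *(3)] by auto
    next
      fix J' assume J': "J' \<subseteq> J" "card J' \<le> Suc n + 1"
      have yJ': "y \<in> fun_cone p n \<inter> halfspaces (Suc n) A H J'" using y sub[OF J'(1)] by auto
      have "\<not> (\<forall>y' \<in> fun_cone p n \<inter> halfspaces (Suc n) A H J'. y' n \<le> max \<beta> ?R + 1)"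
      proof
        assume "\<forall>y' \<in> fun_cone p n \<inter> halfspaces (Suc n) A H J'. y' n \<le> max \<beta> ?R + 1"
        then have "y n \<le> ?R"
          using J' finite_subset[OF J'(1) J] yJ'
          by (intro few_halfspaces_bound(2)[OF sr p _ _ bd, of J']) auto
        then show False using \<open>\<not> y n \<le> ?R\<close> by simp
      qed
      then show "\<exists>y\<in>?X. \<forall>j\<in>J'. (\<Sum>i<Suc n. of_int (A j i) * y i) \<le> real_of_int (H j)"
        by (force simp: halfspaces_def)
    qed
    then obtain y' where "y' \<in> ?X" "y' \<in> halfspaces (Suc n) A H J" by (auto simp: halfspaces_def)
    then show False using bounded[of y'] by auto
  qed
qed

section \<open>Return to matrices, vectors and norms\<close>

lemma bit_size_bound:
  assumes "bit_size b \<le> \<tau>"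
  shows "1 \<le> \<tau>" "\<bar>b\<bar> \<le> 2 ^ \<tau>"
proof -
  show "1 \<le> \<tau>" using assms by (auto simp: bit_size_def split: if_splits)
  show "\<bar>b\<bar> \<le> 2 ^ \<tau>"
  proof (cases "b = 0")
    case False
    then have pos: "0 < \<bar>real_of_int b\<bar>" by simp
    have "nat \<lfloor>log 2 \<bar>real_of_int b\<bar>\<rfloor> + 1 \<le> \<tau>" using assms False by (simp add: bit_size_def)
    then have "log 2 \<bar>real_of_int b\<bar> \<le> real \<tau>" by linarith
    then have "\<bar>real_of_int b\<bar> \<le> 2 powr real \<tau>" using pos by (simp add: log_le_iff)
    then have "real_of_int \<bar>b\<bar> \<le> real_of_int (2 ^ \<tau>)" by (simp add: powr_realpow)
    then show ?thesis by (simp only: of_int_le_iff)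
  qed simp
qed

lemma p_norm_le_iff:
  assumes "0 < p"
  shows "p_norm p x \<le> z \<longleftrightarrow> 0 \<le> z \<and> (\<Sum>i<dim_vec x. \<bar>x $ i\<bar> powr p) \<le> z powr p"
proof -
  define S where "S = (\<Sum>i<dim_vec x. \<bar>x $ i\<bar> powr p)"
  have S: "0 \<le> S" by (simp add: S_def sum_nonneg)
  have "S powr (1 / p) \<le> z \<longleftrightarrow> 0 \<le> z \<and> S \<le> z powr p"
  proof (intro iffI conjI)
    assume le: "S powr (1 / p) \<le> z"
    show "0 \<le> z" using powr_ge_zero le by (rule order_trans)
    have "(S powr (1 / p)) powr p \<le> z powr p" using le assms by (intro powr_mono2) auto
    then show "S \<le> z powr p" using assms S by (simp add: powr_powr)
  next
    assume z: "0 \<le> z \<and> S \<le> z powr p"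
    then have "S powr (1 / p) \<le> (z powr p) powr (1 / p)" using assms S by (intro powr_mono2) auto
    then show "S powr (1 / p) \<le> z" using assms z by (simp add: powr_powr)
  qed
  then show ?thesis by (simp add: p_norm_def S_def)
qed

definition joint_coeff :: "nat \<Rightarrow> int mat \<Rightarrow> int vec \<Rightarrow> nat \<Rightarrow> nat \<Rightarrow> int" where
  "joint_coeff n F G j i = (if i < n then F $$ (j, i) else G $ j)"

text \<open>\<open>y\<close> is tied to \<open>(x, z)\<close> only on the indices up to
  \<open>n\<close>, so that the lemma translates both from vectors to functions and back.\<close>

lemma feasible_set_iff:
  assumes F: "F \<in> carrier_mat m n" and G: "G \<in> carrier_vec m" and H: "H \<in> carrier_vec m"
    and p: "0 < p" and x: "x \<in> carrier_vec n" and y: "\<And>i. i < n \<Longrightarrow> y i = x $ i" "y n = z"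
  shows "(x, z) \<in> feasible_set p F G H \<longleftrightarrow>
    y \<in> fun_cone p n \<inter> halfspaces (Suc n) (joint_coeff n F G) (\<lambda>j. H $ j) {..<m}"
proof -
  have "(map_mat real_of_int F *\<^sub>v x + z \<cdot>\<^sub>v map_vec real_of_int G) $ j
      = (\<Sum>i<Suc n. of_int (joint_coeff n F G j i) * y i)" if "j < m" for j
    using that F G x y by (simp add: scalar_prod_def joint_coeff_def lessThan_atLeast0 mult.commute)
  then have "map_mat real_of_int F *\<^sub>v x + z \<cdot>\<^sub>v map_vec real_of_int G \<le> map_vec real_of_int H \<longleftrightarrow>
      y \<in> halfspaces (Suc n) (joint_coeff n F G) (\<lambda>j. H $ j) {..<m}"
    using F G H by (auto simp: less_eq_vec_def halfspaces_def)
  moreover have "(x, z) \<in> p_order_cone p n \<longleftrightarrow> y \<in> fun_cone p n"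
    using x y by (simp add: p_order_cone_def p_norm_le_iff[OF p] fun_cone_def)
  ultimately show ?thesis using F by (auto simp: feasible_set_def)
qed

text \<open>Every entry of \<open>x\<close> is at most \<open>z\<close> in absolute value, so on the
  cone the norm and \<open>z\<close> control each other; in particular boundedness of the feasible
  set is boundedness of \<open>z\<close>.\<close>

lemma norm2_le_on_cone:
  assumes x: "x \<in> carrier_vec n" and p: "0 < p"
    and y: "\<And>i. i < n \<Longrightarrow> y i = x $ i" "y n = z" "y \<in> fun_cone p n"
  shows "norm2 (x, z) \<le> real (n + 1) * z" "z \<le> norm2 (x, z)"
proof -
  have z: "0 \<le> z" using y by (simp add: fun_cone_def)
  have "(x $ i)\<^sup>2 \<le> z\<^sup>2" if "i < n" for i
    using fun_cone_abs_le[OF y(3) that p] y(1)[OF that] y(2) z by (intro abs_le_square_iff[THEN iffD1]) simp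
  then have "(\<Sum>i<n. (x $ i)\<^sup>2) \<le> (\<Sum>i<n. z\<^sup>2)" by (intro sum_mono) simp
  then have "(\<Sum>i<n. (x $ i)\<^sup>2) + z\<^sup>2 \<le> real (n + 1) * z\<^sup>2" by (simp add: algebra_simps)
  also have "\<dots> \<le> (real (n + 1))\<^sup>2 * z\<^sup>2" by (intro mult_right_mono) (auto simp: power2_eq_square)
  finally have "(\<Sum>i<n. (x $ i)\<^sup>2) + z\<^sup>2 \<le> (real (n + 1) * z)\<^sup>2" by (simp add: power_mult_distrib)
  then show "norm2 (x, z) \<le> real (n + 1) * z"
    unfolding norm2_def using x z by (simp add: real_le_lsqrt)
  have "z\<^sup>2 \<le> (\<Sum>i<n. (x $ i)\<^sup>2) + z\<^sup>2" by (simp add: sum_nonneg)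
  then show "z \<le> norm2 (x, z)"
    unfolding norm2_def using x by (simp add: real_le_rsqrt)
qed

text \<open>Makes the numerator a function of \<open>p\<close>, so that \<open>R\<close> can take
  \<open>p\<close> as its argument instead of \<open>r\<close> and \<open>s\<close>.\<close>

lemma coprime_quotient_unique:
  fixes r s r' s' :: nat
  assumes "coprime r s" "coprime r' s'" "0 < s" "0 < s'" "real r / real s = real r' / real s'"
  shows "r = r'"
proof -
  have "real (r * s') = real (r' * s)" using assms by (simp add: field_simps)
  then have eq: "r * s' = r' * s" by (simp only: of_nat_eq_iff)
  have "r dvd r' * s" "r' dvd r * s'" unfolding eq[symmetric] by simp_all (simp add: eq)
  then have "r dvd r'" "r' dvd r"
    using assms by (simp_all add: coprime_dvd_mult_left_iff)
  then show ?thesis by (rule dvd_antisym)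
qed

theorem feasible_set_bounds:
  fixes r s n m \<tau> :: nat and p :: real
  assumes sr: "0 < s" "s < r" and p: "p = real r / real s" and n: "2 \<le> n" and m: "1 \<le> m"
    and F: "F \<in> carrier_mat m n" and G: "G \<in> carrier_vec m" and H: "H \<in> carrier_vec m"
    and bits: "entries_bit_size_le F G H \<tau>" and w: "w \<in> feasible_set p F G H"
  shows "\<exists>w \<in> feasible_set p F G H. norm2 w \<le> 2 ^ (\<tau> * (n * r) ^ (33 * n))"
    and "norm2_bounded (feasible_set p F G H) \<Longrightarrow> norm2 w \<le> 2 ^ (\<tau> * (n * r) ^ (33 * n))"
proof -
  let ?A = "joint_coeff n F G" and ?H = "\<lambda>j. H $ j"
  let ?S = "fun_cone p n \<inter> halfspaces (Suc n) ?A ?H {..<m}"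
  define fn where "fn x z i = (if i < n then x $ i else z)" for x :: "real vec" and z :: real and i :: nat
  have p0: "0 < p" using sr by (simp add: p)
  have fn: "(x, z) \<in> feasible_set p F G H \<longleftrightarrow> fn x z \<in> ?S" if "x \<in> carrier_vec n" for x z
    by (rule feasible_set_iff[OF F G H p0 that]) (simp_all add: fn_def)
  have carr: "x \<in> carrier_vec n" if "(x, z) \<in> feasible_set p F G H" for x z
    using that F by (simp add: feasible_set_def p_order_cone_def)
  have vec: "(vec n y, y n) \<in> feasible_set p F G H \<longleftrightarrow> y \<in> ?S" for y
    by (rule feasible_set_iff[OF F G H p0]) simp_all
  have norm_vec: "norm2 (vec n y, y n) \<le> real (n + 1) * y n" "y n \<le> norm2 (vec n y, y n)" if "y \<in> ?S" for y
    using norm2_le_on_cone[of "vec n y" n p y "y n"] that p0 by auto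
  \<comment> \<open>Here \<open>m \<ge> 1\<close> enters: \<open>G\<close> has an entry, and every
    bit size is at least 1.\<close>
  have "1 \<le> \<tau>"
    using bits G m bit_size_bound(1)[of "G $ 0" \<tau>] by (auto simp: entries_bit_size_le_def)
  then have est: "(n + 1) * z_bound n r \<tau> \<le> 2 ^ (\<tau> * (n * r) ^ (33 * n))"
    unfolding z_bound_def using n sr by (intro root_bound_estimate) auto
  have fin: "real (n + 1) * z \<le> 2 ^ (\<tau> * (n * r) ^ (33 * n))" if "z \<le> real (z_bound n r \<tau>)" for z
  proof -
    have "real (n + 1) * z \<le> real ((n + 1) * z_bound n r \<tau>)" 
      unfolding of_nat_mult using that by (intro mult_left_mono) auto
    also have "\<dots> \<le> real (2 ^ (\<tau> * (n * r) ^ (33 * n)))" using est by (simp only: of_nat_le_iff)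
    finally show ?thesis by simp
  qed
  have bd: "\<bar>?H j\<bar> \<le> 2 ^ \<tau>" "i < Suc n \<Longrightarrow> \<bar>?A j i\<bar> \<le> 2 ^ \<tau>" if "j \<in> {..<m}" for i j
    using that bits F G H bit_size_bound(2) unfolding entries_bit_size_le_def joint_coeff_def by auto
  obtain x z where xz: "w = (x, z)" by (cases w)
  have x: "x \<in> carrier_vec n" using carr w xz by blast
  have wS: "fn x z \<in> ?S" using w fn[OF x] by (simp add: xz)
  note bounds = halfspaces_bound[OF sr p finite_lessThan bd wS]
  show "\<exists>w \<in> feasible_set p F G H. norm2 w \<le> 2 ^ (\<tau> * (n * r) ^ (33 * n))"
  proof -
    obtain y where y: "y \<in> ?S" "y n \<le> real (z_bound n r \<tau>)" using bounds(1) by blast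
    have "norm2 (vec n y, y n) \<le> 2 ^ (\<tau> * (n * r) ^ (33 * n))"
      using norm_vec(1)[OF y(1)] fin[OF y(2)] by linarith
    then show ?thesis using vec y(1) by blast
  qed
  show "norm2 w \<le> 2 ^ (\<tau> * (n * r) ^ (33 * n))" if bounded: "norm2_bounded (feasible_set p F G H)"
  proof -
    obtain \<beta> where \<beta>: "\<And>w. w \<in> feasible_set p F G H \<Longrightarrow> norm2 w \<le> \<beta>"
      using bounded unfolding norm2_bounded_def by blast
    have y\<beta>: "y n \<le> \<beta>" if "y \<in> ?S" for y
      using norm_vec(2)[OF that] \<beta>[of "(vec n y, y n)"] vec that by auto
    have "fn x z n \<le> real (z_bound n r \<tau>)"
      by (rule bounds(2)[where \<beta> = \<beta>]) (use y\<beta> in auto)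
    then have "real (n + 1) * z \<le> 2 ^ (\<tau> * (n * r) ^ (33 * n))" by (intro fin) (simp add: fn_def)
    moreover have "norm2 (x, z) \<le> real (n + 1) * z"
      by (rule norm2_le_on_cone(1)[OF x p0, of "fn x z"]) (use wS in \<open>auto simp: fn_def\<close>)
    ultimately show ?thesis by (simp add: xz)
  qed
qed

theorem theorem3p4:
  shows "\<exists>(g :: nat \<Rightarrow> nat \<Rightarrow> real) (R :: real \<Rightarrow> nat \<Rightarrow> nat \<Rightarrow> nat \<Rightarrow> real).
    (\<forall>m n. 1 \<le> m \<longrightarrow> 1 \<le> n \<longrightarrow> 0 < g m n) \<and>
    bigO2 g (\<lambda>m n. real (n * min m n)) \<and>
    (\<forall>(r :: nat) (s :: nat) (p :: real) (n :: nat) (m :: nat) (\<tau> :: nat).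
       0 < s \<and> s < r \<and> coprime r s \<and> p = real r / real s \<and> 2 \<le> n \<and> 1 \<le> m \<longrightarrow>
         0 < R p n m \<tau> \<and>
         log 2 (R p n m \<tau>) = real \<tau> * real (n * r) powr g m n \<and>
         (\<forall>F \<in> carrier_mat m n. \<forall>G \<in> carrier_vec m. \<forall>H \<in> carrier_vec m.
            entries_bit_size_le F G H \<tau> \<and> feasible_set p F G H \<noteq> {} \<longrightarrow>
              (\<exists>w \<in> feasible_set p F G H. norm2 w \<le> R p n m \<tau>) \<and>
              (norm2_bounded (feasible_set p F G H) \<longrightarrow>
                 (\<forall>w \<in> feasible_set p F G H. norm2 w \<le> R p n m \<tau>))))"
proof -
  define numer where "numer p = (THE r. \<exists>s>0. coprime r s \<and> p = real r / real s)" for p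
  \<comment> \<open>Free of \<open>m\<close>, yet in the required class with factor 33, since
    \<open>n \<le> n * min m n\<close> once \<open>m\<close> and \<open>n\<close> are at least
    1.\<close>
  define g :: "nat \<Rightarrow> nat \<Rightarrow> real" where "g m n = real (33 * n)" for m n
  define R :: "real \<Rightarrow> nat \<Rightarrow> nat \<Rightarrow> nat \<Rightarrow> real"
    where "R p n m \<tau> = 2 powr (real \<tau> * real (n * numer p) powr g m n)" for p n m \<tau>
  have numer: "numer p = r" if "0 < s" "coprime r s" "p = real r / real s" for p and r s :: nat
    unfolding numer_def using that by (intro the_equality) (auto dest: coprime_quotient_unique)
  have R_eq: "R p n m \<tau> = 2 ^ (\<tau> * (n * r) ^ (33 * n))"
    if "0 < s" "0 < r" "coprime r s" "p = real r / real s" "2 \<le> n" for p n m \<tau> and r s :: nat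
  proof -
    have "real (n * r) powr real (33 * n) = real ((n * r) ^ (33 * n))"
      using that by (subst powr_realpow) auto
    then have "R p n m \<tau> = 2 powr real (\<tau> * (n * r) ^ (33 * n))"
      unfolding R_def g_def numer[OF that(1,3,4)] by (simp only: of_nat_mult)
    then show ?thesis by (simp only: powr_realpow zero_less_numeral)
  qed
  show ?thesis
  proof (intro exI[of _ g] exI[of _ R] conjI allI impI)
    show "0 < g m n" if "1 \<le> m" "1 \<le> n" for m n using that by (simp add: g_def)
    have "g m n \<le> real 33 * real (n * min m n)" if "1 \<le> m" "1 \<le> n" for m n
    proof -
      have "33 * n \<le> 33 * (n * min m n)" using that by simp
      then show ?thesis unfolding g_def by (simp only: of_nat_le_iff flip: of_nat_mult)
    qed
    then show "bigO2 g (\<lambda>m n. real (n * min m n))" unfolding bigO2_def by blast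
  next
    fix r s n m \<tau> :: nat and p :: real
    assume *: "0 < s \<and> s < r \<and> coprime r s \<and> p = real r / real s \<and> 2 \<le> n \<and> 1 \<le> m"
    show "0 < R p n m \<tau>" by (simp add: R_def)
    show "log 2 (R p n m \<tau>) = real \<tau> * real (n * r) powr g m n"
      using * numer[of s r p] by (simp add: R_def)
    have R: "R p n m \<tau> = 2 ^ (\<tau> * (n * r) ^ (33 * n))" using * by (intro R_eq) auto
    have bounds: "(\<exists>w \<in> feasible_set p F G H. norm2 w \<le> R p n m \<tau>) \<and>
        (norm2_bounded (feasible_set p F G H) \<longrightarrow>
           (\<forall>w \<in> feasible_set p F G H. norm2 w \<le> R p n m \<tau>))"
      if "F \<in> carrier_mat m n" "G \<in> carrier_vec m" "H \<in> carrier_vec m"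
        "entries_bit_size_le F G H \<tau> \<and> feasible_set p F G H \<noteq> {}" for F G H
      using feasible_set_bounds[of s r p n m F G H \<tau>] * that unfolding R by blast
    show "\<forall>F \<in> carrier_mat m n. \<forall>G \<in> carrier_vec m. \<forall>H \<in> carrier_vec m.
            entries_bit_size_le F G H \<tau> \<and> feasible_set p F G H \<noteq> {} \<longrightarrow>
              (\<exists>w \<in> feasible_set p F G H. norm2 w \<le> R p n m \<tau>) \<and>
              (norm2_bounded (feasible_set p F G H) \<longrightarrow>
                 (\<forall>w \<in> feasible_set p F G H. norm2 w \<le> R p n m \<tau>))"
      using bounds by (intro ballI impI) blast
  qed
qed

end
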